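(* Let $x\in D_1$, $\nu\in\mathbb{C}$, $\mu\in\mathbb{C}\setminus\mathbb{Z}$ with $\nu+\mu\notin-\mathbb{N}$. Then $$\mathsf{Q}_\nu^\mu(x)=\frac{-2^\nu}{(1-x)^{\nu+1}}\Bigg[\Gamma(\mu)\cos(\pi\nu)\left(\frac{1-x}{1+x}\right)^{\frac12\mu}{}_2F_1\!\left(\nu+1,\nu-\mu+1;1-\mu;\frac{x+1}{x-1}\right)+\frac{\Gamma(-\mu)\cos(\pi(\nu+\mu))\Gamma(\nu+\mu+1)}{\Gamma(\nu-\mu+1)}\left(\frac{1+x}{1-x}\right)^{\frac12\mu}{}_2F_1\!\left(\nu+1,\nu+\mu+1;1+\mu;\frac{x+1}{x-1}\right)\Bigg].$$
   Context: $\mathbb{N}=\{1,2,3,\dots\}$, $-\mathbb{N}=\{-1,-2,\dots\}$. $D_1=\mathbb{C}\setminus((-\infty,-1]\cup[1,\infty))$, $D_2=\mathbb{C}\setminus(-\infty,1]$. Complex powers are principal values. ${}_2F_1(a,b;c;w)$ is the Gauss hypergeometric function, principal branch on $\mathbb{C}\setminus[1,\infty)$ (the analytic continuation of $\sum_{n\ge0}\frac{(a)_n(b)_n}{(c)_n}\frac{w^n}{n!}$). $1/\Gamma$ is read as the entire function (zero at the poles of $\Gamma$), and a quotient ${}_2F_1(a,b;c;w)/\Gamma(c)$ with $c\in\{0,-1,-2,\dots\}$ is read as the regularized function (continuous in $c$). Associated Legendre function of the second kind: for $z\in D_2$, $\nu+\mu\in\mathbb{C}\setminus-\mathbb{N}$,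 $$Q_\nu^\mu(z)=\frac{\sqrt{\pi}\,e^{i\pi\mu}\Gamma(\nu+\mu+1)(z^2-1)^{\frac12\mu}}{2^{\nu+1}\Gamma(\nu+\frac32)z^{\nu+\mu+1}}\,{}_2F_1\!\left(\tfrac{\nu+\mu+2}{2},\tfrac{\nu+\mu+1}{2};\nu+\tfrac32;\tfrac1{z^2}\right),$$ where $(z^2-1)^\alpha:=(z+1)^\alpha(z-1)^\alpha$. Ferrers function of the second kind: for $x\in(-1,1)$, $$\mathsf{Q}_\nu^\mu(x)=\tfrac12\big[e^{-\frac12 i\pi\mu}\,e^{-i\pi\mu}Q_\nu^\mu(x+i0)+e^{\frac12 i\pi\mu}\,e^{-i\pi\mu}Q_\nu^\mu(x-i0)\big],$$ where $x\pm i0$ denotes the limit from the upper/lower half-plane, and $\mathsf{Q}_\nu^\mu$ is extended analytically to $D_1$. *)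

theory Defs
  imports "HOL-Complex_Analysis.Complex_Analysis"
begin

definition D1 :: "complex set" where
  "D1 = - (of_real ` {..-1} \<union> of_real ` {1..})"

(* Meant for S open and connected, with A a subset of S having a limit point in S: the values
   on S are then determined by the identity theorem, provided that an extension exists.  Values
   outside S are unspecified. *)
definition analytic_extension ::
    "complex set \<Rightarrow> complex set \<Rightarrow> (complex \<Rightarrow> complex) \<Rightarrow> complex \<Rightarrow> complex" where
  "analytic_extension A S f = (SOME g. g holomorphic_on S \<and> (\<forall>z\<in>A. g z = f z))"

(* Principal branch on the plane cut along [1, oo).  The last argument 1 of fps_hypergeo is the
   scaling of the variable.  Only meaningful for c not in {0, -1, -2, ...}. *)
definition hyp2F1 :: "complex \<Rightarrow> complex \<Rightarrow> complex \<Rightarrow> complex \<Rightarrow> complex" where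
  "hyp2F1 a b c =
     analytic_extension (ball 0 1) (- (of_real ` {1..})) (eval_fps (fps_hypergeo [a, b] [c] 1))"

(* Olver's regularized function, for arbitrary c.  As rGamma (c + n) = rGamma c / pochhammer c n
   when c is not in {0, -1, -2, ...}, its coefficients are those of 2F1(a, b; c; w) / Gamma(c) for
   such c, and they are entire functions of c. *)
definition hyp2F1_reg :: "complex \<Rightarrow> complex \<Rightarrow> complex \<Rightarrow> complex \<Rightarrow> complex" where
  "hyp2F1_reg a b c =
     analytic_extension (ball 0 1) (- (of_real ` {1..}))
       (eval_fps (Abs_fps (\<lambda>n. pochhammer a n * pochhammer b n * rGamma (c + of_nat n) / fact n)))"

(* The quotient 2F1(a, b; c; w) / Gamma(c). *)
definition hyp2F1_over_Gamma :: "complex \<Rightarrow> complex \<Rightarrow> complex \<Rightarrow> complex \<Rightarrow> complex" where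
  "hyp2F1_over_Gamma a b c w =
     (if c \<in> \<int>\<^sub>\<le>\<^sub>0 then hyp2F1_reg a b c w else hyp2F1 a b c w / Gamma c)"

(* For z outside (-oo, 1] and \<nu> + \<mu> not in {-1, -2, ...}.  The power (z^2 - 1)^(\<mu>/2) is by
   convention (z + 1)^(\<mu>/2) (z - 1)^(\<mu>/2), and the factor 1 / Gamma (\<nu> + 3/2) is absorbed in
   hyp2F1_over_Gamma. *)
definition legendre_Q :: "complex \<Rightarrow> complex \<Rightarrow> complex \<Rightarrow> complex" where
  "legendre_Q \<nu> \<mu> z =
     of_real (sqrt pi) * exp (\<i> * of_real pi * \<mu>) * Gamma (\<nu> + \<mu> + 1)
       * ((z + 1) powr (\<mu> / 2) * (z - 1) powr (\<mu> / 2))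
       / (2 powr (\<nu> + 1) * z powr (\<nu> + \<mu> + 1))
       * hyp2F1_over_Gamma ((\<nu> + \<mu> + 2) / 2) ((\<nu> + \<mu> + 1) / 2) (\<nu> + 3 / 2) (1 / z ^ 2)"

(* Ferrers function of the second kind at x in the real segment (-1, 1). *)
definition ferrers_Q_segment :: "complex \<Rightarrow> complex \<Rightarrow> complex \<Rightarrow> complex" where
  "ferrers_Q_segment \<nu> \<mu> x =
     1 / 2 *
       (exp (- (\<i> * of_real pi * \<mu> / 2)) * exp (- (\<i> * of_real pi * \<mu>))
          * Lim (at x within {z. Im z > 0}) (legendre_Q \<nu> \<mu>)
        + exp (\<i> * of_real pi * \<mu> / 2) * exp (- (\<i> * of_real pi * \<mu>))
          * Lim (at x within {z. Im z < 0}) (legendre_Q \<nu> \<mu>))"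

definition ferrers_Q :: "complex \<Rightarrow> complex \<Rightarrow> complex \<Rightarrow> complex" where
  "ferrers_Q \<nu> \<mu> = analytic_extension (of_real ` {-1<..<1}) D1 (ferrers_Q_segment \<nu> \<mu>)"

end

theory Submission
  imports Defs "HOL-Real_Asymp.Real_Asymp"
begin

text \<open>
  Let \<open>F\<close> be the regularized hypergeometric function, whose Taylor coefficients are entire in the
  parameters.  Put \<open>w = (z - 1) / (z + 1)\<close>.  For \<open>z > 1\<close>, the Legendre function is an elementary factor
  times \<open>L(w) = w^\<mu> (1 + w)^(-\<nu>-\<mu>-1) F(((1 - w) / (1 + w))^2)\<close>, and \<open>L\<close> satisfies the same hypergeometric
  equation as the Frobenius solutions \<open>F1(w)\<close> and \<open>w^\<mu> F2(w)\<close> at \<open>w = 0\<close>.  By constancy of Wronskians,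
  \<open>L\<close> is a combination of the two.  For real \<open>\<nu> > 0\<close> and \<open>0 < \<mu> < 1\<close>, the first coefficient is read off
  at \<open>w = 0\<close>; the second one follows from the first, because \<open>L\<close> stays bounded at \<open>w = 1\<close> while both
  Frobenius solutions blow up like \<open>(1 - w)^(-2\<nu>-1)\<close> with known constants.  After regularization both
  sides of the resulting identity are entire in \<open>\<nu>\<close> and \<open>\<mu>\<close>, so it holds for all parameters.  This expands
  the Legendre function about \<open>z = 1\<close>; since it is multiplied by \<open>exp(i\<pi>(\<nu>+1))\<close> or \<open>exp(-i\<pi>(\<nu>+1))\<close> under \<open>z \<mapsto> -z\<close>, one
  obtains an expansion about \<open>z = -1\<close> on the upper and on the lower half-plane, which continues across
  \<open>(-1, 1)\<close>.  Adding the two boundary values gives the cosines.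
\<close>

section \<open>The regularized hypergeometric series\<close>

text \<open>The obstacle is that \<open>analytic_extension\<close> is a Hilbert choice: a value of
  \<open>hyp2F1\<close> outside the unit disc says nothing until a continuation has been exhibited,
  and an Euler integral would restrict the parameters. The differential equation is therefore pulled
  back to the unit disc along t -> 4 t / (1 + t)^2, where the power series converges in the whole
  disc. The same pullback, read in 1 - v, is the quadratic transformation that brings the argument 1
  / z^2 of the Legendre function to w. The real range 0 < \<mu> < 1, \<nu> > 0 makes all limits
  elementary: w^\<mu> vanishes at 0, and each series examined near 1 has a positive excess a + b - c
  (namely \<mu> for the Legendre series and 2 \<nu> + 1 for both Frobenius series), so its blow-up
  can be read off from the growth of its coefficients. The constant 4^(-\<mu>) comes from 1 - ((1 -
  w) / (1 + w))^2 = 4 w / (1 + w)^2; the duplication and reflection formulas then leave only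
  sqrt(\<pi>), powers of 2 and sin(\<pi>\<mu>).\<close>

definition hyp_reg_fps :: "complex \<Rightarrow> complex \<Rightarrow> complex \<Rightarrow> complex fps" where
  "hyp_reg_fps a b c =
     Abs_fps (\<lambda>n. pochhammer a n * pochhammer b n * rGamma (c + of_nat n) / fact n)"

lemma hyp_reg_fps_0 [simp]: "fps_nth (hyp_reg_fps a b c) 0 = rGamma c"
  by (simp add: hyp_reg_fps_def)

text \<open>The ratio of coefficients is stated without division, so that it survives
  \<open>c + of_nat n = 0\<close>; both sides then vanish.\<close>

lemma hyp_reg_fps_Suc:
  "of_nat (Suc n) * (c + of_nat n) * fps_nth (hyp_reg_fps a b c) (Suc n) =
     (a + of_nat n) * (b + of_nat n) * fps_nth (hyp_reg_fps a b c) n"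
proof -
  have "(c + of_nat n) * rGamma (c + of_nat (Suc n)) = rGamma (c + of_nat n)"
    using rGamma_plus1[of "c + of_nat n"] by (simp add: algebra_simps)
  moreover have "(of_nat (Suc n) :: complex) / fact (Suc n) = 1 / fact n"
    using of_nat_neq_0[of n, where ?'a = complex] by (simp del: of_nat_Suc)
  moreover have "of_nat (Suc n) * (c + of_nat n) * fps_nth (hyp_reg_fps a b c) (Suc n) =
      pochhammer a (Suc n) * pochhammer b (Suc n) * ((c + of_nat n) * rGamma (c + of_nat (Suc n)))
        * (of_nat (Suc n) / fact (Suc n))"
    by (simp add: hyp_reg_fps_def del: of_nat_Suc fact_Suc)
  ultimately show ?thesis
    by (simp add: hyp_reg_fps_def pochhammer_Suc del: of_nat_Suc fact_Suc)
qed

text \<open>Since |c + n| >= n - R, the coefficient ratio is at most (R + n)^2 / ((n + 1) (n - R)),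
  which tends to 1. Uniformity in \<open>a\<close>, \<open>b\<close>, \<open>c\<close> is what later
  yields holomorphy in the parameters, beyond mere convergence.\<close>

lemma hyp_reg_fps_ratio:
  assumes "r < 1" "0 < R"
  obtains N \<rho> where "0 < \<rho>" "\<rho> < 1"
    "\<And>n a b c w. \<lbrakk>n \<ge> N; norm a \<le> R; norm b \<le> R; norm c \<le> R; norm w \<le> r\<rbrakk> \<Longrightarrow>
      norm (fps_nth (hyp_reg_fps a b c) (Suc n) * w ^ Suc n)
        \<le> \<rho> * norm (fps_nth (hyp_reg_fps a b c) n * w ^ n)"
proof -
  define s where "s = max r 0"
  \<comment> \<open>The midpoint of \<open>s\<close> and 1: the bound on the term ratio tends to
    \<open>s\<close>, so it eventually drops below \<rho>.\<close>
  define \<rho> where "\<rho> = (1 + s) / 2"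
  have s: "0 \<le> s" "s < 1" "r \<le> s" and \<rho>: "0 < \<rho>" "\<rho> < 1" "s < \<rho>"
    using assms by (auto simp: s_def \<rho>_def)
  have "((\<lambda>n. (R + real n) ^ 2 / (real (Suc n) * (real n - R)) * s) \<longlongrightarrow> 1 * s) sequentially"
    by (intro tendsto_mult tendsto_const) real_asymp
  from order_tendstoD(2)[OF this, of \<rho>] \<rho>
  have "eventually (\<lambda>n. (R + real n) ^ 2 / (real (Suc n) * (real n - R)) * s < \<rho>) sequentially"
    by simp
  moreover have "eventually (\<lambda>n. real n > R) sequentially"
    by real_asymp
  ultimately have "eventually (\<lambda>n. (R + real n) ^ 2 * s \<le> \<rho> * (real (Suc n) * (real n - R)) \<and> real n > R) sequentially"
  proof eventually_elim
    case (elim n)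
    have "real (Suc n) * (real n - R) > 0" using elim by simp
    with elim show ?case by (simp add: pos_divide_less_eq del: of_nat_Suc)
  qed
  then obtain N where N: "\<And>n. n \<ge> N \<Longrightarrow> (R + real n) ^ 2 * s \<le> \<rho> * (real (Suc n) * (real n - R)) \<and> real n > R"
    by (auto simp: eventually_at_top_linorder)
  show ?thesis
  proof (rule that[OF \<rho>(1,2)])
    fix n a b c w
    assume n: "n \<ge> N" and le: "norm (a::complex) \<le> R" "norm (b::complex) \<le> R" "norm (c::complex) \<le> R" "norm (w::complex) \<le> r"
    let ?u = "fps_nth (hyp_reg_fps a b c)"
    define K where "K = real (Suc n) * (real n - R)"
    have K: "K > 0" using N[OF n] by (simp add: K_def)
    have "real n - R \<le> norm (c + of_nat n)"
      using le(3) norm_triangle_ineq4[of "c + of_nat n" c] by simp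
    hence "K \<le> real (Suc n) * norm (c + of_nat n)"
      unfolding K_def by (intro mult_left_mono) auto
    hence "K * norm (?u (Suc n) * w ^ Suc n) \<le> real (Suc n) * norm (c + of_nat n) * norm (?u (Suc n) * w ^ Suc n)"
      by (intro mult_right_mono) auto
    also have "\<dots> = norm (of_nat (Suc n) * (c + of_nat n) * ?u (Suc n)) * norm (w ^ Suc n)"
      unfolding norm_mult norm_of_nat by (simp only: mult_ac)
    also have "\<dots> = (norm (a + of_nat n) * norm (b + of_nat n) * norm w) * norm (?u n * w ^ n)"
      unfolding hyp_reg_fps_Suc by (simp add: norm_mult mult_ac)
    also have "\<dots> \<le> ((R + real n) * (R + real n) * s) * norm (?u n * w ^ n)"
    proof (intro mult_right_mono mult_mono)
      show "norm (a + of_nat n) \<le> R + real n" "norm (b + of_nat n) \<le> R + real n"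
        using le norm_triangle_ineq[of a "of_nat n"] norm_triangle_ineq[of b "of_nat n"] by auto
    qed (use le s assms in auto)
    also have "\<dots> \<le> (\<rho> * K) * norm (?u n * w ^ n)"
      using N[OF n] by (intro mult_right_mono) (auto simp: K_def power2_eq_square)
    finally have "K * norm (?u (Suc n) * w ^ Suc n) \<le> K * (\<rho> * norm (?u n * w ^ n))"
      by (simp add: mult_ac)
    thus "norm (?u (Suc n) * w ^ Suc n) \<le> \<rho> * norm (?u n * w ^ n)"
      using K by simp
  qed
qed

lemma hyp_reg_fps_conv_radius: "fps_conv_radius (hyp_reg_fps a b c) \<ge> 1"
  unfolding fps_conv_radius_def
proof (rule conv_radius_geI_ex')
  fix r :: real assume r: "0 < r" "ereal r < 1"
  hence "r < 1" by simp
  define R where "R = norm a + norm b + norm c + 1"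
  have "0 < R" unfolding R_def using norm_ge_zero[of a] norm_ge_zero[of b] norm_ge_zero[of c] by linarith
  obtain N \<rho> where N: "0 < \<rho>" "\<rho> < 1"
    "\<And>n a b c w. \<lbrakk>n \<ge> N; norm a \<le> R; norm b \<le> R; norm c \<le> R; norm w \<le> r\<rbrakk> \<Longrightarrow>
      norm (fps_nth (hyp_reg_fps a b c) (Suc n) * w ^ Suc n)
        \<le> \<rho> * norm (fps_nth (hyp_reg_fps a b c) n * w ^ n)"
    by (rule hyp_reg_fps_ratio[OF \<open>r < 1\<close> \<open>0 < R\<close>]) (rule that; assumption)
  show "summable (\<lambda>n. fps_nth (hyp_reg_fps a b c) n * of_real r ^ n)"
    by (rule summable_ratio_test[OF N(2)], rule N(3)) (use r in \<open>auto simp: R_def\<close>)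
qed

lemma hyp_reg_fps_conv_radius':
  "norm w < 1 \<Longrightarrow> ereal (norm w) < fps_conv_radius (hyp_reg_fps a b c)"
  using hyp_reg_fps_conv_radius[of a b c] by (meson ereal_less(3) less_le_trans)

text \<open>Weierstrass M-test: each term is entire in t because \<open>rGamma\<close> is, and the
  uniform ratio bound gives a geometric majorant near every point. This makes the identity theorem
  available in \<mu> and \<nu> at fixed w.\<close>

lemma eval_hyp_reg_fps_holomorphic_params:
  assumes "A holomorphic_on UNIV" "B holomorphic_on UNIV" "C holomorphic_on UNIV" "norm w < 1"
  shows "(\<lambda>t. eval_fps (hyp_reg_fps (A t) (B t) (C t)) w) holomorphic_on UNIV"
proof -
  define u where "u n t = fps_nth (hyp_reg_fps (A t) (B t) (C t)) n * w ^ n" for n t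
  have hol: "u n holomorphic_on UNIV" for n
    unfolding u_def hyp_reg_fps_def fps_nth_Abs_fps
    by (intro holomorphic_intros assms) auto
  have "(\<lambda>t. \<Sum>n. u n t) holomorphic_on UNIV"
  proof (rule holomorphic_uniform_sequence)
    show "(\<lambda>t. \<Sum>i<n. u i t) holomorphic_on UNIV" for n
      by (intro holomorphic_intros hol)
  next
    fix x :: complex
    let ?K = "cball x 1"
    have bdd: "\<exists>b>0. \<forall>t\<in>?K. norm (f t) \<le> b" if "f holomorphic_on UNIV" for f
    proof -
      have "continuous_on ?K f"
        using that by (meson holomorphic_on_imp_continuous_on continuous_on_subset subset_UNIV)
      hence "bounded (f ` ?K)" by (intro compact_imp_bounded compact_continuous_image) auto
      thus ?thesis unfolding bounded_pos by auto
    qed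
    obtain ba where ba: "ba > 0" "\<And>t. t \<in> ?K \<Longrightarrow> norm (A t) \<le> ba" using bdd[OF assms(1)] by auto
    obtain bb where bb: "bb > 0" "\<And>t. t \<in> ?K \<Longrightarrow> norm (B t) \<le> bb" using bdd[OF assms(2)] by auto
    obtain bc where bc: "bc > 0" "\<And>t. t \<in> ?K \<Longrightarrow> norm (C t) \<le> bc" using bdd[OF assms(3)] by auto
    define R where "R = ba + bb + bc"
    have "R > 0" using ba bb bc by (simp add: R_def)
    obtain N \<rho> where N: "0 < \<rho>" "\<rho> < 1"
      "\<And>n a b c z. \<lbrakk>n \<ge> N; norm a \<le> R; norm b \<le> R; norm c \<le> R; norm z \<le> norm w\<rbrakk> \<Longrightarrow>
        norm (fps_nth (hyp_reg_fps a b c) (Suc n) * z ^ Suc n)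
          \<le> \<rho> * norm (fps_nth (hyp_reg_fps a b c) n * z ^ n)"
      by (rule hyp_reg_fps_ratio[OF \<open>norm w < 1\<close> \<open>R > 0\<close>]) (rule that; assumption)
    obtain M where M: "M > 0" "\<And>t. t \<in> ?K \<Longrightarrow> norm (u N t) \<le> M" using bdd[OF hol[of N]] by auto
    \<comment> \<open>The ratio bound holds only from \<open>N\<close> on, so the majorant is
      anchored at the term of index \<open>N\<close>, which is bounded on the compact disc.\<close>
    have bound: "norm (u n t) \<le> M * \<rho> ^ (n - N)" if "n \<ge> N" "t \<in> ?K" for n t
      using that(1)
    proof (induction n rule: dec_induct)
      case base
      thus ?case using M(2)[OF that(2)] by simp
    next
      case (step n)
      have "norm (A t) \<le> R" "norm (B t) \<le> R" "norm (C t) \<le> R"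
        using ba(1) bb(1) bc(1) ba(2)[OF that(2)] bb(2)[OF that(2)] bc(2)[OF that(2)] by (auto simp: R_def)
      hence "norm (u (Suc n) t) \<le> \<rho> * norm (u n t)"
        unfolding u_def using step by (intro N(3)) auto
      also have "\<dots> \<le> \<rho> * (M * \<rho> ^ (n - N))"
        using step N by (intro mult_left_mono) auto
      also have "\<dots> = M * \<rho> ^ (Suc n - N)"
        using step by (simp add: Suc_diff_le)
      finally show ?case .
    qed
    have "summable (\<lambda>n. \<rho> ^ (n + N - N))"
      using N by (simp add: summable_geometric)
    hence "summable (\<lambda>n. \<rho> ^ (n - N))"
      by (subst (asm) summable_iff_shift[of "\<lambda>n. \<rho> ^ (n - N)" N]) auto
    hence "uniform_limit ?K (\<lambda>n t. \<Sum>i<n. u i t) (\<lambda>t. \<Sum>n. u n t) sequentially"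
      using bound by (intro Weierstrass_m_test_ev[where M = "\<lambda>n. M * \<rho> ^ (n - N)"] summable_mult)
        (auto simp: eventually_at_top_linorder intro!: exI[of _ N])
    thus "\<exists>d>0. cball x d \<subseteq> UNIV \<and> uniform_limit (cball x d) (\<lambda>n t. \<Sum>i<n. u i t) (\<lambda>t. \<Sum>n. u n t) sequentially"
      by (intro exI[of _ 1]) auto
  qed auto
  thus ?thesis by (simp add: u_def eval_fps_def)
qed

lemma hyp_reg_fps_ode:
  fixes a b c :: complex
  defines "F \<equiv> hyp_reg_fps a b c"
  shows "fps_X * (1 - fps_X) * fps_deriv (fps_deriv F)
     + (fps_const c - fps_const (a + b + 1) * fps_X) * fps_deriv F - fps_const (a * b) * F = 0"
proof (rule fps_ext)
  fix n
  have "fps_X * (1 - fps_X) * fps_deriv (fps_deriv F)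
     + (fps_const c - fps_const (a + b + 1) * fps_X) * fps_deriv F - fps_const (a * b) * F =
     fps_X * fps_deriv (fps_deriv F) - fps_X * (fps_X * fps_deriv (fps_deriv F))
     + fps_const c * fps_deriv F - fps_const (a + b + 1) * (fps_X * fps_deriv F) - fps_const (a * b) * F"
    by (simp add: algebra_simps)
  also have "fps_nth \<dots> n = of_nat (Suc n) * (c + of_nat n) * fps_nth F (Suc n) - (a + of_nat n) * (b + of_nat n) * fps_nth F n"
  proof (cases n)
    case 0
    thus ?thesis by simp
  next
    case [simp]: (Suc k)
    show ?thesis by (cases k) (simp_all add: algebra_simps)
  qed
  also have "\<dots> = 0" unfolding F_def hyp_reg_fps_Suc by simp
  finally show "fps_nth (fps_X * (1 - fps_X) * fps_deriv (fps_deriv F)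
     + (fps_const c - fps_const (a + b + 1) * fps_X) * fps_deriv F - fps_const (a * b) * F) n = fps_nth 0 n" by simp
qed

lemma hyp_reg_fps_deriv_conv_radius:
  "norm w < 1 \<Longrightarrow> ereal (norm w) < fps_conv_radius (fps_deriv (hyp_reg_fps a b c))"
  "norm w < 1 \<Longrightarrow> ereal (norm w) < fps_conv_radius (fps_deriv (fps_deriv (hyp_reg_fps a b c)))"
  using hyp_reg_fps_conv_radius'[of w a b c]
    fps_conv_radius_deriv[of "hyp_reg_fps a b c"] fps_conv_radius_deriv[of "fps_deriv (hyp_reg_fps a b c)"]
  by (meson less_le_trans)+

lemma hyp_reg_fps_has_derivative:
  assumes "norm w < 1"
  shows "(eval_fps (hyp_reg_fps a b c) has_field_derivative
           eval_fps (fps_deriv (hyp_reg_fps a b c)) w) (at w within A)"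
    and "(eval_fps (fps_deriv (hyp_reg_fps a b c)) has_field_derivative
           eval_fps (fps_deriv (fps_deriv (hyp_reg_fps a b c))) w) (at w within A)"
  by (intro has_field_derivative_eval_fps hyp_reg_fps_conv_radius' hyp_reg_fps_deriv_conv_radius assms)+

lemma eval_hyp_reg_fps_ode:
  fixes a b c w :: complex
  defines "F \<equiv> hyp_reg_fps a b c"
  assumes w: "norm w < 1"
  shows "w * (1 - w) * eval_fps (fps_deriv (fps_deriv F)) w
     + (c - (a + b + 1) * w) * eval_fps (fps_deriv F) w - a * b * eval_fps F w = 0"
proof -
  note conv = hyp_reg_fps_conv_radius'[OF w, of a b c, folded F_def]
    hyp_reg_fps_deriv_conv_radius[OF w, of a b c, folded F_def]
  have exp: "eval_fps (fps_deriv (fps_deriv F)) has_fps_expansion fps_deriv (fps_deriv F)"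
    "eval_fps (fps_deriv F) has_fps_expansion fps_deriv F" "eval_fps F has_fps_expansion F"
    using conv by (intro eval_fps_has_fps_expansion; meson norm_ge_zero ereal_less_eq(5) less_le_trans le_less_trans)+
  have "(\<lambda>w. w * (1 - w) * eval_fps (fps_deriv (fps_deriv F)) w
     + (c - (a + b + 1) * w) * eval_fps (fps_deriv F) w - a * b * eval_fps F w)
     has_fps_expansion 0"
    unfolding hyp_reg_fps_ode[of a b c, folded F_def, symmetric]
    by (intro fps_expansion_intros exp)
  moreover have "(\<lambda>w. w * (1 - w) * eval_fps (fps_deriv (fps_deriv F)) w
     + (c - (a + b + 1) * w) * eval_fps (fps_deriv F) w - a * b * eval_fps F w) holomorphic_on ball 0 1"
    unfolding F_def
    by (intro holomorphic_intros) (auto intro: hyp_reg_fps_conv_radius' hyp_reg_fps_deriv_conv_radius)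
  ultimately show ?thesis
    by (rule has_fps_expansion_0_analytic_continuation) (use w in auto)
qed

text \<open>For R > 1 the sequence K R^n eventually dominates the recurrence, because \<alpha> R +
  \<beta> tends to 1 < R^2. Hence \<open>h n\<close> is O(R^n) for every R > 1.\<close>

lemma conv_radius_three_term:
  fixes h :: "nat \<Rightarrow> complex" and \<alpha> \<beta> :: "nat \<Rightarrow> real"
  assumes "\<alpha> \<longlonglongrightarrow> 0" "\<beta> \<longlonglongrightarrow> 1"
  assumes "eventually (\<lambda>n. 0 \<le> \<alpha> n \<and> 0 \<le> \<beta> n \<and>
             norm (h (Suc (Suc n))) \<le> \<alpha> n * norm (h (Suc n)) + \<beta> n * norm (h n)) sequentially"
  shows "conv_radius h \<ge> 1"
proof (rule conv_radius_geI_ex')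
  fix r :: real assume r: "0 < r" "ereal r < 1"
  obtain q where q: "r < q" "q < 1" using r dense[of r 1] by auto
  \<comment> \<open>Chosen so that R > 1 and R r < 1.\<close>
  define R where "R = 1 / q"
  have R: "R > 1" using q r by (simp add: R_def)
  have "(\<lambda>n. \<alpha> n * R + \<beta> n) \<longlonglongrightarrow> 0 * R + 1"
    by (intro tendsto_intros assms)
  moreover have "0 * R + 1 < R ^ 2" using R by (simp add: one_less_power)
  ultimately have "eventually (\<lambda>n. \<alpha> n * R + \<beta> n < R ^ 2) sequentially"
    using order_tendstoD(2) by blast
  with assms(3) have "eventually (\<lambda>n. \<alpha> n * R + \<beta> n < R ^ 2 \<and> 0 \<le> \<alpha> n \<and> 0 \<le> \<beta> n \<and>
             norm (h (Suc (Suc n))) \<le> \<alpha> n * norm (h (Suc n)) + \<beta> n * norm (h n)) sequentially"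
    by eventually_elim auto
  then obtain N where N: "\<And>n. n \<ge> N \<Longrightarrow> \<alpha> n * R + \<beta> n < R ^ 2 \<and> 0 \<le> \<alpha> n \<and> 0 \<le> \<beta> n \<and>
             norm (h (Suc (Suc n))) \<le> \<alpha> n * norm (h (Suc n)) + \<beta> n * norm (h n)"
    by (auto simp: eventually_at_top_linorder)
  define K where "K = norm (h N) / R ^ N + norm (h (Suc N)) / R ^ Suc N"
  have K: "norm (h N) \<le> K * R ^ N" "norm (h (Suc N)) \<le> K * R ^ Suc N" "K \<ge> 0"
    using R by (auto simp: K_def field_simps)
  have bound: "norm (h n) \<le> K * R ^ n \<and> norm (h (Suc n)) \<le> K * R ^ Suc n" if "n \<ge> N" for n
    using that
  proof (induction n rule: dec_induct)
    case base
    thus ?case using K by auto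
  next
    case (step n)
    have "norm (h (Suc (Suc n))) \<le> \<alpha> n * norm (h (Suc n)) + \<beta> n * norm (h n)"
      using N[of n] step by auto
    also have "\<dots> \<le> \<alpha> n * (K * R ^ Suc n) + \<beta> n * (K * R ^ n)"
      using N[of n] step by (intro add_mono mult_left_mono) auto
    also have "\<dots> = (\<alpha> n * R + \<beta> n) * (K * R ^ n)" by (simp add: algebra_simps)
    also have "\<dots> \<le> R ^ 2 * (K * R ^ n)"
      using N[of n] step K R by (intro mult_right_mono) auto
    also have "\<dots> = K * R ^ Suc (Suc n)" by (simp add: power2_eq_square)
    finally show ?case using step by auto
  qed
  show "summable (\<lambda>n. h n * of_real r ^ n)"
  proof (rule summable_comparison_test)
    have "norm (h n * of_real r ^ n) \<le> K * (R * r) ^ n" if "n \<ge> N" for n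
    proof -
      have "norm (h n * of_real r ^ n) = norm (h n) * r ^ n"
        using r by (simp add: norm_mult norm_power)
      also have "\<dots> \<le> (K * R ^ n) * r ^ n"
        using bound[OF that] r by (intro mult_right_mono) auto
      finally show ?thesis by (simp add: power_mult_distrib)
    qed
    thus "\<exists>N. \<forall>n\<ge>N. norm (h n * of_real r ^ n) \<le> K * (R * r) ^ n" by blast
    show "summable (\<lambda>n. K * (R * r) ^ n)"
      using q r by (intro summable_mult summable_geometric) (auto simp: R_def)
  qed
qed

text \<open>The algebra of the change of variables: \<open>\<psi>1\<close> and
  \<open>\<psi>2\<close> are the derivatives of \<open>\<psi>\<close>, \<open>p\<close> stands for
  (1 + t)^(-2a), and \<open>H1\<close>, \<open>H2\<close> are the derivatives of t -> p
  f(\<psi>(t)). Multiplying the original equation by 4 p (1 - t) / (1 + t) clears every power of 1 +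
  t, and the coefficients become polynomials in t.\<close>

lemma koebe_pullback_ode_aux:
  fixes a b c t p f f1 f2 :: complex
  assumes t: "1 + t \<noteq> 0"
  defines "\<psi> \<equiv> 4 * t / (1 + t)^2"
  defines "\<psi>1 \<equiv> 4 * (1 - t) / (1 + t)^3"
  defines "\<psi>2 \<equiv> 8 * (t - 2) / (1 + t)^4"
  defines "H1 \<equiv> p * (f1 * \<psi>1 - 2 * a * f / (1 + t))"
  defines "H2 \<equiv> p * (f2 * \<psi>1^2 + f1 * \<psi>2 - 4 * a * f1 * \<psi>1 / (1 + t) + 2 * a * (2 * a + 1) * f / (1 + t)^2)"
  assumes ode: "\<psi> * (1 - \<psi>) * f2 + (c - (a + b + 1) * \<psi>) * f1 - a * b * f = 0"
  shows "t * (1 - t^2) * H2 + (c + (2 * c - 4 * b) * t + (c - 4 * a - 2) * t^2) * H1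
    + 2 * a * ((c - 2 * b) + (c - 2 * a - 1) * t) * (p * f) = 0"
proof -
  \<comment> \<open>In \<open>u\<close> all denominators are monomials, so a polynomial identity
    remains once they are cleared.\<close>
  define u where "u = 1 + t"
  have u: "u \<noteq> 0" "t = u - 1" using t by (auto simp: u_def)
  have "t * (1 - t^2) * H2 + (c + (2 * c - 4 * b) * t + (c - 4 * a - 2) * t^2) * H1
    + 2 * a * ((c - 2 * b) + (c - 2 * a - 1) * t) * (p * f) =
    p * (4 * (1 - t) / (1 + t)) * (\<psi> * (1 - \<psi>) * f2 + (c - (a + b + 1) * \<psi>) * f1 - a * b * f)"
    unfolding H1_def H2_def \<psi>_def \<psi>1_def \<psi>2_def u_def[symmetric]
    using u(1) unfolding u(2)
    by (simp add: divide_simps power2_eq_square power3_eq_cube power4_eq_xxxx) algebra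
  thus ?thesis unfolding ode by simp
qed

section \<open>Continuation to the slit plane\<close>

abbreviation slit :: "complex set" where "slit \<equiv> - (of_real ` {1..})"

lemma slit_iff: "w \<in> slit \<longleftrightarrow> 1 - w \<notin> \<real>\<^sub>\<le>\<^sub>0"
proof -
  have "w \<in> of_real ` {1..} \<longleftrightarrow> 1 - w \<in> \<real>\<^sub>\<le>\<^sub>0"
  proof
    assume "1 - w \<in> \<real>\<^sub>\<le>\<^sub>0"
    hence "w = of_real (Re w)" "Re w \<ge> 1"
      by (auto simp: complex_nonpos_Reals_iff complex_eq_iff)
    thus "w \<in> of_real ` {1..}" by (intro image_eqI[of _ _ "Re w"]) simp_all
  qed (auto simp: complex_nonpos_Reals_iff)
  thus ?thesis by auto
qed

lemma open_slit: "open slit"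
proof -
  have "slit = (\<lambda>w. 1 - w) -` (- \<real>\<^sub>\<le>\<^sub>0)"
  proof (rule set_eqI)
    fix w :: complex
    show "w \<in> slit \<longleftrightarrow> w \<in> (\<lambda>w. 1 - w) -` (- \<real>\<^sub>\<le>\<^sub>0)"
      unfolding vimage_eq Compl_iff[of _ "\<real>\<^sub>\<le>\<^sub>0"] by (rule slit_iff)
  qed
  moreover have "open ((\<lambda>w. 1 - w :: complex) -` (- \<real>\<^sub>\<le>\<^sub>0))"
    by (intro open_vimage open_Compl closed_nonpos_Reals_complex continuous_intros)
  ultimately show ?thesis by simp
qed

lemma starlike_slit: "starlike slit"
  unfolding starlike_def
proof (intro bexI ballI subsetI)
  show "(0::complex) \<in> slit" by auto
  fix x z :: complex assume x: "x \<in> slit" and z: "z \<in> closed_segment 0 x"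
  then obtain t where t: "0 \<le> t" "t \<le> 1" "z = of_real t * x"
    by (auto simp: in_segment scaleR_conv_of_real)
  show "z \<in> slit"
  proof (rule ccontr)
    assume "z \<notin> slit"
    then obtain r where r: "r \<ge> 1" "of_real t * x = of_real r" using t by auto
    hence "t \<noteq> 0" by auto
    hence "x = of_real (r / t)" using r t by (simp add: field_simps)
    moreover have "r / t \<ge> 1" using r t \<open>t \<noteq> 0\<close> by (simp add: field_simps)
    ultimately have "x \<in> of_real ` {1..}" by (intro image_eqI[of _ _ "r / t"]) simp_all
    thus False using x by simp
  qed
qed

lemma connected_slit: "connected slit"
  by (rule starlike_imp_connected[OF starlike_slit])

lemma ball_subset_slit: "ball 0 1 \<subseteq> slit"
proof
  fix w :: complex assume "w \<in> ball 0 1"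
  thus "w \<in> slit" by auto
qed

lemma has_fps_expansion_unique:
  fixes f :: "complex \<Rightarrow> complex"
  assumes "f has_fps_expansion F" "f has_fps_expansion G"
  shows "F = G"
  using fps_nth_fps_expansion[OF assms(1)] fps_nth_fps_expansion[OF assms(2)]
  by (intro fps_ext) simp

text \<open>
  \<open>koebe\<close> maps the unit disc onto the plane cut along \<open>[1, \<infinity>)\<close>.  The factor \<open>(1 + t)^(-2a)\<close> removes
  the exponent \<open>2a\<close> at \<open>t = -1\<close>, the preimage of \<open>\<infinity>\<close>, so that the pulled back equation has a three-term
  recurrence.  \<open>koebe_pull1\<close> and \<open>koebe_pull2\<close> are the first two derivatives of \<open>koebe_pull\<close> when
  \<open>g1\<close> and \<open>g2\<close> are those of \<open>g\<close>.
\<close>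

definition koebe :: "complex \<Rightarrow> complex" where "koebe t = 4 * t / (1 + t)^2"

definition koebe_pull :: "complex \<Rightarrow> (complex \<Rightarrow> complex) \<Rightarrow> complex \<Rightarrow> complex" where
  "koebe_pull a g t = (1 + t) powr (- 2 * a) * g (koebe t)"

definition koebe_pull1 :: "complex \<Rightarrow> (complex \<Rightarrow> complex) \<Rightarrow> (complex \<Rightarrow> complex) \<Rightarrow> complex \<Rightarrow> complex" where
  "koebe_pull1 a g g1 t = (1 + t) powr (- 2 * a) * (g1 (koebe t) * (4 * (1 - t) / (1 + t)^3) - 2 * a * g (koebe t) / (1 + t))"

definition koebe_pull2 :: "complex \<Rightarrow> (complex \<Rightarrow> complex) \<Rightarrow> (complex \<Rightarrow> complex) \<Rightarrow> (complex \<Rightarrow> complex) \<Rightarrow> complex \<Rightarrow> complex" where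
  "koebe_pull2 a g g1 g2 t = (1 + t) powr (- 2 * a) *
     (g2 (koebe t) * (4 * (1 - t) / (1 + t)^3)^2 + g1 (koebe t) * (8 * (t - 2) / (1 + t)^4)
      - 4 * a * g1 (koebe t) * (4 * (1 - t) / (1 + t)^3) / (1 + t) + 2 * a * (2 * a + 1) * g (koebe t) / (1 + t)^2)"

lemma koebe_pull_has_derivative:
  assumes t: "1 + t \<notin> \<real>\<^sub>\<le>\<^sub>0"
    and g: "(g has_field_derivative g1 (koebe t)) (at (koebe t))"
    and g1: "(g1 has_field_derivative g2 (koebe t)) (at (koebe t))"
  shows "(koebe_pull a g has_field_derivative koebe_pull1 a g g1 t) (at t)"
    and "(koebe_pull1 a g g1 has_field_derivative koebe_pull2 a g g1 g2 t) (at t)"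
proof -
  define \<psi>1 where "\<psi>1 t = 4 * (1 - t) / (1 + t)^3" for t :: complex
  define p where "p t = (1 + t) powr (- 2 * a)" for t
  have t1: "1 + t \<noteq> 0" using t by (intro notI) simp
  have d\<psi>: "(koebe has_field_derivative \<psi>1 t) (at t)"
    unfolding koebe_def \<psi>1_def using t1
    by (auto intro!: derivative_eq_intros) (simp add: divide_simps power2_eq_square power3_eq_cube, algebra)
  have d\<psi>1: "(\<psi>1 has_field_derivative 8 * (t - 2) / (1 + t)^4) (at t)"
    unfolding \<psi>1_def using t1
    by (auto intro!: derivative_eq_intros) (simp add: divide_simps power2_eq_square power3_eq_cube power4_eq_xxxx, algebra)
  have dp: "(p has_field_derivative - 2 * a / (1 + t) * p t) (at t)"
    unfolding p_def using t1 t
    by (auto intro!: derivative_eq_intros simp: powr_diff)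
  have df: "((\<lambda>t. g (koebe t)) has_field_derivative g1 (koebe t) * \<psi>1 t) (at t)"
    "((\<lambda>t. g1 (koebe t)) has_field_derivative g2 (koebe t) * \<psi>1 t) (at t)"
    using DERIV_chain2[OF g d\<psi>] DERIV_chain2[OF g1 d\<psi>] by auto
  have "((\<lambda>t. p t * g (koebe t)) has_field_derivative p t * (g1 (koebe t) * \<psi>1 t - 2 * a * g (koebe t) / (1 + t))) (at t)"
    using t1 by (auto intro!: derivative_eq_intros dp df simp: algebra_simps)
  thus "(koebe_pull a g has_field_derivative koebe_pull1 a g g1 t) (at t)"
    by (simp add: koebe_pull_def [abs_def] koebe_pull1_def p_def \<psi>1_def)
  have "((\<lambda>t. p t * (g1 (koebe t) * \<psi>1 t - 2 * a * g (koebe t) / (1 + t))) has_field_derivative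
     (- 2 * a / (1 + t) * p t) * (g1 (koebe t) * \<psi>1 t - 2 * a * g (koebe t) / (1 + t)) +
     p t * ((g2 (koebe t) * \<psi>1 t) * \<psi>1 t + g1 (koebe t) * (8 * (t - 2) / (1 + t)^4)
       - (2 * a * (g1 (koebe t) * \<psi>1 t) * (1 + t) - 2 * a * g (koebe t)) / ((1 + t) * (1 + t)))) (at t)"
    using t1 df by (auto intro!: derivative_eq_intros dp d\<psi>1 simp: mult_ac)
  also have "(- 2 * a / (1 + t) * p t) * (g1 (koebe t) * \<psi>1 t - 2 * a * g (koebe t) / (1 + t)) +
     p t * ((g2 (koebe t) * \<psi>1 t) * \<psi>1 t + g1 (koebe t) * (8 * (t - 2) / (1 + t)^4)
       - (2 * a * (g1 (koebe t) * \<psi>1 t) * (1 + t) - 2 * a * g (koebe t)) / ((1 + t) * (1 + t))) = koebe_pull2 a g g1 g2 t"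
  proof -
    have aux: "(- 2 * a / u * P) * (X * Y - 2 * a * Z / u) +
        P * ((W * Y) * Y + X * V - (2 * a * (X * Y) * u - 2 * a * Z) / (u * u)) =
        P * (W * Y^2 + X * V - 4 * a * X * Y / u + 2 * a * (2 * a + 1) * Z / u^2)"
      if "u \<noteq> 0" for u P X Y Z W V :: complex
      using that by (simp add: divide_simps power2_eq_square) algebra
    show ?thesis unfolding koebe_pull2_def \<psi>1_def[symmetric] p_def[symmetric] by (rule aux) (rule t1)
  qed
  finally show "(koebe_pull1 a g g1 has_field_derivative koebe_pull2 a g g1 g2 t) (at t)"
    by (simp add: koebe_pull1_def [abs_def] p_def \<psi>1_def)
qed

lemma koebe_pull_ode:
  assumes t: "1 + t \<noteq> 0"
  assumes ode: "koebe t * (1 - koebe t) * g2 (koebe t) + (c - (a + b + 1) * koebe t) * g1 (koebe t) - a * b * g (koebe t) = 0"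
  shows "t * (1 - t^2) * koebe_pull2 a g g1 g2 t + (c + (2 * c - 4 * b) * t + (c - 4 * a - 2) * t^2) * koebe_pull1 a g g1 t
    + 2 * a * ((c - 2 * b) + (c - 2 * a - 1) * t) * koebe_pull a g t = 0"
  using koebe_pullback_ode_aux[OF t, of "g2 (koebe t)" c a b "g1 (koebe t)" "g (koebe t)" "(1 + t) powr (- 2 * a)"] ode
  unfolding koebe_pull_def koebe_pull1_def koebe_pull2_def koebe_def by blast

text \<open>A priori the pullback is understood only near 0, where \<open>koebe t\<close> lies in
  the disc of convergence. Its Taylor coefficients satisfy a three-term recurrence with limiting
  characteristic equation x^2 = 1, matching the singularities t = 1 and t = -1; hence the Taylor
  series converges in the whole unit disc. This is what carries the hypergeometric series beyond its
  own disc.\<close>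

lemma koebe_pull_fps_expansion:
  fixes a b c :: complex
  obtains h where "koebe_pull a (eval_fps (hyp_reg_fps a b c)) has_fps_expansion h" "fps_conv_radius h \<ge> 1"
proof -
  define F where "F = hyp_reg_fps a b c"
  define H where "H = koebe_pull a (eval_fps F)"
  define H1 where "H1 = koebe_pull1 a (eval_fps F) (eval_fps (fps_deriv F))"
  define H2 where "H2 = koebe_pull2 a (eval_fps F) (eval_fps (fps_deriv F)) (eval_fps (fps_deriv (fps_deriv F)))"
  \<comment> \<open>With |t| < 1/8 one has 4 |t| < 1/2 < (7/8)^2 <= |1 + t|^2, that is, |koebe t| <
    1.\<close>
  define B where "B = ball (0::complex) (1/8)"
  have B: "open B" "0 \<in> B" by (auto simp: B_def)
  have t1: "1 + t \<noteq> 0" "norm (koebe t) < 1" "1 + t \<notin> \<real>\<^sub>\<le>\<^sub>0" if "t \<in> B" for t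
  proof -
    have t: "norm t < 1/8" using that by (simp add: B_def)
    have *: "norm (1 + t) \<ge> 7/8" using t norm_triangle_ineq2[of 1 "-t"] by simp
    thus "1 + t \<noteq> 0" by auto
    have "(7/8)^2 \<le> norm (1 + t) ^ 2" using * by (intro power_mono) auto
    hence "4 * norm t < norm (1 + t) ^ 2" using t by (simp add: power2_eq_square)
    thus "norm (koebe t) < 1"
      using * by (simp add: koebe_def norm_mult norm_divide norm_power divide_simps)
    have "\<bar>Re t\<bar> < 1/8" using t abs_Re_le_cmod[of t] by linarith
    thus "1 + t \<notin> \<real>\<^sub>\<le>\<^sub>0" by (auto simp: complex_nonpos_Reals_iff)
  qed
  have dH: "(H has_field_derivative H1 t) (at t)" "(H1 has_field_derivative H2 t) (at t)" if "t \<in> B" for t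
    unfolding H_def H1_def H2_def
    using koebe_pull_has_derivative[OF t1(3)[OF that], where g = "eval_fps F"
        and ?g1.0 = "eval_fps (fps_deriv F)" and ?g2.0 = "eval_fps (fps_deriv (fps_deriv F))"]
      hyp_reg_fps_has_derivative[OF t1(2)[OF that]] unfolding F_def by blast+
  have "H holomorphic_on B"
    using dH B(1) holomorphic_on_open by blast
  hence exp: "H has_fps_expansion fps_expansion H 0"
    using B by (intro has_fps_expansion_fps_expansion) auto
  define h where "h = fps_expansion H 0"
  have cong: "k has_fps_expansion K" if "\<And>t. t \<in> B \<Longrightarrow> g t = k t" "g has_fps_expansion K" for g k K
  proof -
    have "eventually (\<lambda>t. g t = k t) (nhds 0)"
      using eventually_nhds_in_open[OF B] by eventually_elim (rule that)
    thus ?thesis using that(2) has_fps_expansion_cong[of g k K K] by simp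
  qed
  have expH: "H has_fps_expansion h" using exp by (simp add: h_def)
  have expH1: "H1 has_fps_expansion fps_deriv h"
    using dH by (intro cong[OF _ has_fps_expansion_deriv[OF expH]]) (auto intro: DERIV_imp_deriv)
  have expH2: "H2 has_fps_expansion fps_deriv (fps_deriv h)"
    using dH by (intro cong[OF _ has_fps_expansion_deriv[OF expH1]]) (auto intro: DERIV_imp_deriv)
  have "t * (1 - t^2) * H2 t + (c + (2 * c - 4 * b) * t + (c - 4 * a - 2) * t^2) * H1 t
    + (2 * a * (c - 2 * b) + 2 * a * (c - 2 * a - 1) * t) * H t = 0" if "t \<in> B" for t
    using koebe_pull_ode[OF t1(1)[OF that], where g = "eval_fps F" and ?g1.0 = "eval_fps (fps_deriv F)"
        and ?g2.0 = "eval_fps (fps_deriv (fps_deriv F))", of c a b]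
      eval_hyp_reg_fps_ode[OF t1(2)[OF that], of a b c]
    unfolding H_def H1_def H2_def F_def by (simp add: algebra_simps)
  hence "(\<lambda>t. t * (1 - t^2) * H2 t + (c + (2 * c - 4 * b) * t + (c - 4 * a - 2) * t^2) * H1 t
    + (2 * a * (c - 2 * b) + 2 * a * (c - 2 * a - 1) * t) * H t) has_fps_expansion 0"
    by (intro cong[OF _ has_fps_expansion_0]) auto
  moreover have "(\<lambda>t. t * (1 - t^2) * H2 t + (c + (2 * c - 4 * b) * t + (c - 4 * a - 2) * t^2) * H1 t
    + (2 * a * (c - 2 * b) + 2 * a * (c - 2 * a - 1) * t) * H t) has_fps_expansion
     (fps_X * (1 - fps_X^2) * fps_deriv (fps_deriv h) +
      (fps_const c + fps_const (2 * c - 4 * b) * fps_X + fps_const (c - 4 * a - 2) * fps_X^2) * fps_deriv h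
      + (fps_const (2 * a * (c - 2 * b)) + fps_const (2 * a * (c - 2 * a - 1)) * fps_X) * h)"
    by (intro fps_expansion_intros expH expH1 expH2)
  ultimately have "0 = fps_X * (1 - fps_X^2) * fps_deriv (fps_deriv h) +
      (fps_const c + fps_const (2 * c - 4 * b) * fps_X + fps_const (c - 4 * a - 2) * fps_X^2) * fps_deriv h
      + (fps_const (2 * a * (c - 2 * b)) + fps_const (2 * a * (c - 2 * a - 1)) * fps_X) * h"
    by (rule has_fps_expansion_unique)
  also have "\<dots> = fps_X * fps_deriv (fps_deriv h) - fps_X * (fps_X * (fps_X * fps_deriv (fps_deriv h))) +
      fps_const c * fps_deriv h + fps_const (2 * c - 4 * b) * (fps_X * fps_deriv h) +
      fps_const (c - 4 * a - 2) * (fps_X * (fps_X * fps_deriv h))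
      + fps_const (2 * a * (c - 2 * b)) * h + fps_const (2 * a * (c - 2 * a - 1)) * (fps_X * h)"
    by (simp add: algebra_simps power2_eq_square)
  finally have eq0: "0 = fps_nth (fps_X * fps_deriv (fps_deriv h) - fps_X * (fps_X * (fps_X * fps_deriv (fps_deriv h))) +
      fps_const c * fps_deriv h + fps_const (2 * c - 4 * b) * (fps_X * fps_deriv h) +
      fps_const (c - 4 * a - 2) * (fps_X * (fps_X * fps_deriv h))
      + fps_const (2 * a * (c - 2 * b)) * h + fps_const (2 * a * (c - 2 * a - 1)) * (fps_X * h)) (Suc m)" for m
    by (metis fps_zero_nth)
  \<comment> \<open>The coefficient of t^(m+1) in the equation. The middle term is of order m only,
    whereas the outer ones are of order m^2; this gives the limits 0 and 1 demanded by
    \<open>conv_radius_three_term\<close>.\<close>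
  have rec: "of_nat (m + 2) * (of_nat m + 1 + c) * fps_nth h (Suc (Suc m)) =
      - (2 * c - 4 * b) * (of_nat m + 1 + a) * fps_nth h (Suc m)
      + (of_nat m + 2 * a) * (of_nat m + (2 * a + 1 - c)) * fps_nth h m" for m
  proof -
    define M where "M = (of_nat m :: complex)"
    have "0 = (M + 1) * (M + 2) * fps_nth h (Suc (Suc m)) - M * (M - 1) * fps_nth h m
       + c * ((M + 2) * fps_nth h (Suc (Suc m))) + (2 * c - 4 * b) * ((M + 1) * fps_nth h (Suc m))
       + (c - 4 * a - 2) * (M * fps_nth h m) + 2 * a * (c - 2 * b) * fps_nth h (Suc m)
       + 2 * a * (c - 2 * a - 1) * fps_nth h m"
    proof (cases m)
      case 0
      thus ?thesis using eq0[of m] by (simp add: M_def)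
    next
      case (Suc k)
      thus ?thesis using eq0[of m] by (cases k) (simp_all add: M_def algebra_simps)
    qed
    moreover have "of_nat (m + 2) = M + 2" by (simp add: M_def)
    ultimately show ?thesis unfolding M_def[symmetric] by algebra
  qed
  define R where "R = 1 + norm c + norm (2 * c - 4 * b) + norm (2 * a) + norm (2 * a + 1 - c) + norm (1 + a)"
  have R: "R > 0" "norm c \<le> R" "norm (2 * c - 4 * b) \<le> R" "norm (2 * a) \<le> R" "norm (2 * a + 1 - c) \<le> R" "norm (1 + a) \<le> R"
    unfolding R_def
    using norm_ge_zero[of c] norm_ge_zero[of "2 * c - 4 * b"] norm_ge_zero[of "2 * a"]
      norm_ge_zero[of "2 * a + 1 - c"] norm_ge_zero[of "1 + a"] by linarith+
  have "conv_radius (fps_nth h) \<ge> 1"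
  proof (rule conv_radius_three_term)
    define D where "D m = (real m + 2) * (real m - R)" for m
    show "(\<lambda>m. R * (real m + R) / D m) \<longlonglongrightarrow> 0" unfolding D_def by real_asymp
    show "(\<lambda>m. (real m + R) ^ 2 / D m) \<longlonglongrightarrow> 1" unfolding D_def by real_asymp
    have "eventually (\<lambda>m. real m > R) sequentially" by real_asymp
    thus "eventually (\<lambda>n. 0 \<le> R * (real n + R) / D n \<and> 0 \<le> (real n + R) ^ 2 / D n \<and>
        norm (fps_nth h (Suc (Suc n))) \<le>
          R * (real n + R) / D n * norm (fps_nth h (Suc n)) + (real n + R) ^ 2 / D n * norm (fps_nth h n)) sequentially"
    proof eventually_elim
      case (elim m)
      have D: "D m > 0" using elim R by (simp add: D_def)
      have *: "norm (of_nat m + z) \<le> real m + R" if "norm z \<le> R" for z :: complex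
        using norm_triangle_ineq[of "of_nat m" z] that by simp
      have "real m - R \<le> norm (of_nat m + 1 + c)"
        using norm_triangle_ineq2[of "of_nat (Suc m)" "- c"] R(2) unfolding norm_of_nat
        by (simp add: add.commute)
      hence "D m * norm (fps_nth h (Suc (Suc m))) \<le> (real m + 2) * norm (of_nat m + 1 + c) * norm (fps_nth h (Suc (Suc m)))"
        unfolding D_def by (intro mult_right_mono mult_left_mono) auto
      also have "\<dots> = norm (of_nat (m + 2) * (of_nat m + 1 + c) * fps_nth h (Suc (Suc m)))"
        unfolding norm_mult norm_of_nat by simp
      also have "\<dots> \<le> norm (2 * c - 4 * b) * norm (of_nat m + (1 + a)) * norm (fps_nth h (Suc m)) +
          norm (of_nat m + 2 * a) * norm (of_nat m + (2 * a + 1 - c)) * norm (fps_nth h m)"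
        unfolding rec by (rule order_trans[OF norm_triangle_ineq]) (simp only: norm_mult norm_minus_cancel add.assoc order_refl)
      also have "\<dots> \<le> R * (real m + R) * norm (fps_nth h (Suc m)) +
          (real m + R) * (real m + R) * norm (fps_nth h m)"
        by (intro add_mono mult_right_mono mult_mono * R) (use R in auto)
      finally have "norm (fps_nth h (Suc (Suc m))) \<le> (R * (real m + R) * norm (fps_nth h (Suc m)) +
          (real m + R) * (real m + R) * norm (fps_nth h m)) / D m"
        using D by (simp add: pos_le_divide_eq mult.commute)
      thus ?case using D R by (simp add: add_divide_distrib power2_eq_square)
    qed
  qed
  thus ?thesis using that[of h] expH by (simp add: fps_conv_radius_def H_def F_def)
qed

text \<open>The Taylor series of the pullback is composed with the inverse of the Koebe map, and the
  factor (1 + t)^(-2a) is undone. Existence is all that is needed here, since it gives the Hilbert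
  choice in \<open>analytic_extension\<close> its meaning.\<close>

lemma hyp_reg_extension:
  "\<exists>g. g holomorphic_on slit \<and> (\<forall>w\<in>ball 0 1. g w = eval_fps (hyp_reg_fps a b c) w)"
proof -
  define F where "F = hyp_reg_fps a b c"
  obtain h where h: "koebe_pull a (eval_fps F) has_fps_expansion h" "fps_conv_radius h \<ge> 1"
    unfolding F_def by (rule koebe_pull_fps_expansion)
  \<comment> \<open>The inverse of \<open>koebe\<close> with values in the unit disc: w = koebe t
    means ((1 - t) / (1 + t))^2 = 1 - w, and the principal root has positive real part on the slit
    plane.\<close>
  define T where "T w = (1 - csqrt (1 - w)) / (1 + csqrt (1 - w))" for w
  define g where "g w = (1 + T w) powr (2 * a) * eval_fps h (T w)" for w
  have T: "1 + csqrt (1 - w) \<noteq> 0" "norm (T w) < 1" "1 + T w \<notin> \<real>\<^sub>\<le>\<^sub>0" "4 * T w / (1 + T w)^2 = w"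
    if "w \<in> slit" for w
  proof -
    define s where "s = csqrt (1 - w)"
    have "Re s \<ge> 0" using csqrt_principal[of "1 - w"] by (auto simp: s_def)
    have s2: "s ^ 2 = 1 - w" by (simp add: s_def)
    have "Re s \<noteq> 0"
    proof
      assume "Re s = 0"
      hence "1 - w = - of_real (Im s * Im s)"
        unfolding s2[symmetric] by (simp add: complex_eq_iff power2_eq_square)
      hence "1 - w \<in> \<real>\<^sub>\<le>\<^sub>0" by (simp add: complex_nonpos_Reals_iff)
      thus False using that slit_iff by blast
    qed
    with \<open>Re s \<ge> 0\<close> have s: "Re s > 0" by simp
    hence s1: "1 + s \<noteq> 0" by (auto simp: complex_eq_iff)
    thus "1 + csqrt (1 - w) \<noteq> 0" by (simp add: s_def)
    have Ts: "T w = (1 - s) / (1 + s)" by (simp add: T_def s_def)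
    have "norm (1 - s) < norm (1 + s)"
      unfolding cmod_def using s by (intro real_sqrt_less_mono) (simp add: power2_eq_square algebra_simps)
    thus *: "norm (T w) < 1" using s1 by (simp add: Ts norm_divide divide_simps)
    hence "\<bar>Re (T w)\<bar> < 1" using abs_Re_le_cmod[of "T w"] by linarith
    thus "1 + T w \<notin> \<real>\<^sub>\<le>\<^sub>0" by (auto simp: complex_nonpos_Reals_iff)
    have "1 + T w = 2 / (1 + s)" using s1 by (simp add: Ts divide_simps)
    hence "4 * T w / (1 + T w)^2 = 4 * ((1 - s) / (1 + s)) / (2 / (1 + s))^2" by (simp add: Ts)
    also have "\<dots> = (1 - s) * (1 + s)" using s1 by (simp add: power2_eq_square)
    also have "\<dots> = 1 - s^2" by (simp add: algebra_simps power2_eq_square)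
    finally have "4 * T w / (1 + T w)^2 = 1 - s^2" .
    thus "4 * T w / (1 + T w)^2 = w" by (simp add: s2)
  qed
  have Th: "T holomorphic_on slit"
    unfolding T_def using T(1) slit_iff by (intro holomorphic_intros) blast+
  have "ereal (norm (T w)) < fps_conv_radius h" if "w \<in> slit" for w
    using T(2)[OF that] h(2) by (meson ereal_less(3) less_le_trans)
  hence "T ` slit \<subseteq> eball 0 (fps_conv_radius h)" by auto
  from holomorphic_on_compose_gen[OF Th holomorphic_on_eval_fps[OF order_refl] this]
  have "(\<lambda>w. eval_fps h (T w)) holomorphic_on slit" by (simp add: o_def)
  moreover have "(\<lambda>w. (1 + T w) powr (2 * a)) holomorphic_on slit"
    using T(3) by (intro holomorphic_intros Th) auto
  ultimately have gh: "g holomorphic_on slit"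
    unfolding g_def by (rule holomorphic_on_mult[rotated])
  have "eventually (\<lambda>t. eval_fps h t = (1 + t) powr (- 2 * a) * eval_fps F (4 * t / (1 + t)^2)) (nhds 0)"
    using h(1) by (simp add: has_fps_expansion_def koebe_pull_def koebe_def)
  then obtain X where X: "open X" "0 \<in> X"
    "\<And>t. t \<in> X \<Longrightarrow> eval_fps h t = (1 + t) powr (- 2 * a) * eval_fps F (4 * t / (1 + t)^2)"
    by (auto simp: eventually_nhds)
  have Tc: "continuous_on slit T"
    by (rule holomorphic_on_imp_continuous_on[OF Th])
  have TX: "open (slit \<inter> T -` X)"
    by (rule continuous_open_preimage[OF Tc open_slit X(1)])
  have "g w = eval_fps F w" if "w \<in> ball 0 1" for w
  \<comment> \<open>The expansion at t = 0 yields agreement only where \<open>T w\<close> is near 0;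
    the identity theorem spreads it over the unit disc.\<close>
  proof (rule analytic_continuation_open[of "T -` X \<inter> ball 0 1" "ball 0 1" g "eval_fps F"])
    have "T -` X \<inter> ball 0 1 = (slit \<inter> T -` X) \<inter> ball 0 1" using ball_subset_slit by blast
    thus "open (T -` X \<inter> ball 0 1)" using TX by (simp only: open_Int open_ball)
    have "0 \<in> T -` X \<inter> ball 0 1" using X(2) by (simp add: T_def)
    thus "T -` X \<inter> ball 0 1 \<noteq> {}" by blast
    show "g holomorphic_on ball 0 1" using gh ball_subset_slit by (rule holomorphic_on_subset)
    show "eval_fps F holomorphic_on ball 0 1"
      unfolding F_def by (intro holomorphic_intros) (auto intro: hyp_reg_fps_conv_radius')
    show "g z = eval_fps F z" if "z \<in> T -` X \<inter> ball 0 1" for z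
    proof -
      have z: "z \<in> slit" using that ball_subset_slit by auto
      have "g z = (1 + T z) powr (2 * a) * (1 + T z) powr (- 2 * a) * eval_fps F z"
        using X(3)[of "T z"] that T(4)[OF z] by (simp add: g_def)
      also have "(1 + T z) powr (2 * a) * (1 + T z) powr (- 2 * a) = 1"
      proof -
        have "1 + T z \<noteq> 0" using T(3)[OF z] by (intro notI) simp
        thus ?thesis by (simp add: powr_minus)
      qed
      finally show ?thesis by simp
    qed
  qed (use that in auto)
  with gh show ?thesis unfolding F_def by blast
qed

section \<open>Uniqueness of continuations, and reduction of 2F1 to the regularized function\<close>

lemma analytic_extension_unique:
  assumes "g holomorphic_on S" "\<And>z. z \<in> A \<Longrightarrow> g z = f z"
    and "open S" "connected S" "A \<subseteq> S" "\<xi> \<in> S" "\<xi> islimpt A" "z \<in> S"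
  shows "analytic_extension A S f z = g z"
proof -
  let ?P = "\<lambda>g. g holomorphic_on S \<and> (\<forall>z\<in>A. g z = f z)"
  define g' where "g' = analytic_extension A S f"
  have "?P g'" unfolding g'_def analytic_extension_def using assms(1,2) by (intro someI[of ?P g]) auto
  hence "g' z - g z = 0"
    using analytic_continuation[of "\<lambda>z. g' z - g z" S A \<xi> z] assms by (simp add: holomorphic_on_diff)
  thus ?thesis by (simp add: g'_def)
qed

lemma hyp2F1_reg_holomorphic: "hyp2F1_reg a b c holomorphic_on slit"
  and hyp2F1_reg_eq: "norm w < 1 \<Longrightarrow> hyp2F1_reg a b c w = eval_fps (hyp_reg_fps a b c) w"
proof -
  let ?P = "\<lambda>g. g holomorphic_on slit \<and> (\<forall>w\<in>ball 0 1. g w = eval_fps (hyp_reg_fps a b c) w)"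
  have "hyp2F1_reg a b c = (SOME g. ?P g)"
    by (simp add: hyp2F1_reg_def analytic_extension_def hyp_reg_fps_def)
  hence "?P (hyp2F1_reg a b c)"
    using someI_ex[OF hyp_reg_extension[of a b c]] by simp
  thus "hyp2F1_reg a b c holomorphic_on slit"
    "norm w < 1 \<Longrightarrow> hyp2F1_reg a b c w = eval_fps (hyp_reg_fps a b c) w" by auto
qed

lemma hyp2F1_conv_reg:
  assumes "c \<notin> \<int>\<^sub>\<le>\<^sub>0" "w \<in> slit"
  shows "hyp2F1 a b c w = Gamma c * hyp2F1_reg a b c w"
  unfolding hyp2F1_def
proof (rule analytic_extension_unique[where \<xi> = 0])
  show "(\<lambda>w. Gamma c * hyp2F1_reg a b c w) holomorphic_on slit"
    by (intro holomorphic_intros hyp2F1_reg_holomorphic)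
  have G: "Gamma c \<noteq> 0" using assms by (simp add: Gamma_eq_zero_iff)
  have "fps_hypergeo [a, b] [c] 1 = fps_const (Gamma c) * hyp_reg_fps a b c"
  proof (rule fps_ext)
    fix n
    have "pochhammer c n \<noteq> 0" using assms by (auto simp: pochhammer_eq_0_iff)
    moreover have "pochhammer c n * rGamma (c + of_nat n) * Gamma c = rGamma c * Gamma c"
      using pochhammer_rGamma[of c n] by simp
    hence "pochhammer c n * rGamma (c + of_nat n) * Gamma c = 1"
      using G by (simp add: rGamma_inverse_Gamma)
    ultimately have "rGamma (c + of_nat n) = 1 / (pochhammer c n * Gamma c)"
      using G by (simp add: field_simps)
    thus "fps_nth (fps_hypergeo [a, b] [c] 1) n = fps_nth (fps_const (Gamma c) * hyp_reg_fps a b c) n"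
      using G by (simp add: hyp_reg_fps_def)
  qed
  thus "Gamma c * hyp2F1_reg a b c z = eval_fps (fps_hypergeo [a, b] [c] 1) z" if "z \<in> ball 0 1" for z
    using that hyp_reg_fps_conv_radius'[of z a b c]
    by (simp add: hyp2F1_reg_eq eval_fps_mult)
qed (use assms open_slit connected_slit ball_subset_slit in \<open>auto simp: islimpt_ball\<close>)

lemma hyp2F1_over_Gamma_conv_reg:
  assumes "w \<in> slit"
  shows "hyp2F1_over_Gamma a b c w = hyp2F1_reg a b c w"
  using assms by (auto simp: hyp2F1_over_Gamma_def hyp2F1_conv_reg Gamma_eq_zero_iff)

section \<open>Behaviour at 1\<close>

text \<open>An Abelian comparison theorem: the tail of the difference from K V is at most (e / 2) V,
  while the finitely many remaining terms stay bounded and are negligible because V tends to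
  infinity.\<close>

lemma abel_ratio_limit:
  fixes u :: "nat \<Rightarrow> complex" and v :: "nat \<Rightarrow> real" and V :: "real \<Rightarrow> real"
  assumes v: "\<And>n. v n > 0" and lim: "(\<lambda>n. u n / of_real (v n)) \<longlonglongrightarrow> K"
    and V: "\<And>x. \<lbrakk>0 < x; x < 1\<rbrakk> \<Longrightarrow> (\<lambda>n. v n * x ^ n) sums V x"
    and u: "\<And>x. \<lbrakk>0 < x; x < 1\<rbrakk> \<Longrightarrow> summable (\<lambda>n. norm (u n * of_real x ^ n))"
    and Vtop: "filterlim V at_top (at_left 1)"
  shows "((\<lambda>x. (\<Sum>n. u n * of_real x ^ n) / of_real (V x)) \<longlongrightarrow> K) (at_left 1)"
proof (rule tendstoI)
  fix e :: real assume e: "e > 0"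
  define d where "d n = u n - K * of_real (v n)" for n
  have "eventually (\<lambda>n. dist (u n / of_real (v n)) K < e / 2) sequentially"
    using lim e by (intro tendstoD) auto
  then obtain N where N: "\<And>n. n \<ge> N \<Longrightarrow> dist (u n / of_real (v n)) K < e / 2"
    by (auto simp: eventually_at_top_linorder)
  have dN: "norm (d n) \<le> e / 2 * v n" if "n \<ge> N" for n
  proof -
    have "d n = (u n / of_real (v n) - K) * of_real (v n)"
      using v[of n] by (simp add: d_def field_simps)
    hence "norm (d n) = norm (u n / of_real (v n) - K) * v n"
      using v[of n] by (simp add: norm_mult)
    also have "\<dots> \<le> e / 2 * v n"
      using N[OF that] v[of n] by (intro mult_right_mono) (auto simp: dist_norm)
    finally show ?thesis .
  qed
  define B where "B = (\<Sum>n<N. norm (d n))"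
  have B: "B \<ge> 0" by (simp add: B_def sum_nonneg)
  have "eventually (\<lambda>x. V x > 2 * B / e) (at_left 1)"
    using Vtop by (simp add: filterlim_at_top_dense)
  moreover have "eventually (\<lambda>x. x \<in> {0<..<1::real}) (at_left 1)"
    by (rule eventually_at_left_real) simp
  ultimately show "eventually (\<lambda>x. dist ((\<Sum>n. u n * of_real x ^ n) / of_real (V x)) K < e) (at_left 1)"
  proof eventually_elim
    case (elim x)
    hence x: "0 < x" "x < 1" by auto
    have Vx: "V x > 0" using elim B e by (smt (verit) divide_nonneg_pos mult_nonneg_nonneg)
    define r where "r n = (if n < N then norm (d n) else 0) + e / 2 * (v n * x ^ n)" for n
    have "(\<lambda>n. if n < N then norm (d n) else 0) sums B"
      using sums_If_finite_set[of "{..<N}" "\<lambda>n. norm (d n)"] by (simp add: B_def)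
    hence rs: "r sums (B + e / 2 * V x)"
      unfolding r_def by (intro sums_add sums_mult V x)
    have le: "norm (d n * of_real x ^ n) \<le> r n" for n
    proof (cases "n < N")
      case True
      have "norm (d n * of_real x ^ n) = norm (d n) * x ^ n" using x by (simp add: norm_mult norm_power)
      also have "\<dots> \<le> norm (d n) * 1" using x by (intro mult_left_mono power_le_one) auto
      also have "\<dots> \<le> r n" using True e v[of n] x by (simp add: r_def)
      finally show ?thesis .
    next
      case False
      have "norm (d n * of_real x ^ n) = norm (d n) * x ^ n" using x by (simp add: norm_mult norm_power)
      also have "\<dots> \<le> (e / 2 * v n) * x ^ n" using x dN[of n] False by (intro mult_right_mono) auto
      also have "\<dots> = r n" using False by (simp add: r_def)
      finally show ?thesis .
    qed
    have us: "summable (\<lambda>n. u n * of_real x ^ n)"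
      using u[OF x] by (rule summable_norm_cancel)
    have "(\<lambda>n. of_real (v n * x ^ n) :: complex) sums of_real (V x)"
      using V[OF x] by (rule sums_of_real)
    hence vs: "(\<lambda>n. K * of_real (v n * x ^ n)) sums (K * of_real (V x))"
      by (rule sums_mult)
    have "(\<lambda>n. u n * of_real x ^ n - K * of_real (v n * x ^ n)) sums
        ((\<Sum>n. u n * of_real x ^ n) - K * of_real (V x))"
      by (intro sums_diff vs summable_sums us)
    hence ds: "(\<lambda>n. d n * of_real x ^ n) sums ((\<Sum>n. u n * of_real x ^ n) - K * of_real (V x))"
      by (simp add: d_def algebra_simps)
    have "norm ((\<Sum>n. u n * of_real x ^ n) - K * of_real (V x)) \<le> B + e / 2 * V x"
      using norm_suminf_le[of "\<lambda>n. d n * of_real x ^ n" r] le rs ds by (simp add: sums_iff)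
    also have "\<dots> < e * V x" using elim e by (simp add: field_simps)
    finally have "norm ((\<Sum>n. u n * of_real x ^ n) - K * of_real (V x)) < e * V x" .
    moreover have "(\<Sum>n. u n * of_real x ^ n) / of_real (V x) - K
        = ((\<Sum>n. u n * of_real x ^ n) - K * of_real (V x)) / of_real (V x)"
      using Vx by (simp add: diff_divide_distrib)
    ultimately show ?case using Vx by (simp add: dist_norm norm_divide divide_less_eq)
  qed
qed

text \<open>Gauss's limit formula for 1/Gamma, applied to all four parameters: the powers of n
  cancel because a + b = c + s. As \<open>rGamma_series\<close> at n contains
  \<open>pochhammer\<close> at n + 1, the limit is first proved for the shifted sequence.\<close>

lemma pochhammer_ratio_limit:
  fixes a b c s :: complex
  assumes "a + b = c + s" "s \<notin> \<int>\<^sub>\<le>\<^sub>0" "c \<notin> \<int>\<^sub>\<le>\<^sub>0"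
  shows "(\<lambda>n. pochhammer a n * pochhammer b n * rGamma (c + of_nat n) / pochhammer s n)
     \<longlonglongrightarrow> rGamma a * rGamma b * Gamma s"
proof -
  have nz: "pochhammer s n \<noteq> 0" "pochhammer c n \<noteq> 0" for n
    using assms by (auto simp: pochhammer_eq_0_iff)
  have rG: "rGamma c \<noteq> 0" "rGamma s \<noteq> 0" using assms by (auto simp: rGamma_eq_zero_iff)
  have "(\<lambda>n. rGamma_series a n * rGamma_series b n / (rGamma_series c n * rGamma_series s n) * rGamma c)
      \<longlonglongrightarrow> rGamma a * rGamma b / (rGamma c * rGamma s) * rGamma c"
    using rG by (intro tendsto_intros) auto
  also have "rGamma a * rGamma b / (rGamma c * rGamma s) * rGamma c = rGamma a * rGamma b * Gamma s"
    using rG by (simp add: Gamma_def divide_simps)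
  also have "(\<lambda>n. rGamma_series a n * rGamma_series b n / (rGamma_series c n * rGamma_series s n) * rGamma c) =
     (\<lambda>n. pochhammer a (Suc n) * pochhammer b (Suc n) * rGamma (c + of_nat (Suc n)) / pochhammer s (Suc n))"
  proof
    fix n
    define E where "E z = fact n * exp (z * of_real (ln (of_nat n)))" for z :: complex
    have E0: "E z \<noteq> 0" for z by (simp add: E_def)
    have EE: "E a * E b = E c * E s"
    proof -
      have "exp (a * of_real (ln (of_nat n))) * exp (b * of_real (ln (of_nat n))) =
        (exp (c * of_real (ln (of_nat n))) * exp (s * of_real (ln (of_nat n))) :: complex)"
        unfolding exp_add[symmetric] distrib_right[symmetric] assms(1) ..
      thus ?thesis by (simp add: E_def)
    qed
    have rc: "rGamma c = pochhammer c (Suc n) * rGamma (c + of_nat (Suc n))"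
      by (rule pochhammer_rGamma)
    have "rGamma_series a n * rGamma_series b n / (rGamma_series c n * rGamma_series s n) * rGamma c
       = (pochhammer a (Suc n) * pochhammer b (Suc n) / (E a * E b)) /
         (pochhammer c (Suc n) * pochhammer s (Suc n) / (E c * E s)) * rGamma c"
      by (simp add: rGamma_series_def E_def)
    also have "\<dots> = pochhammer a (Suc n) * pochhammer b (Suc n) / (pochhammer c (Suc n) * pochhammer s (Suc n)) * rGamma c"
      unfolding EE using E0[of c] E0[of s] by (simp add: divide_simps)
    also have "\<dots> = pochhammer a (Suc n) * pochhammer b (Suc n) * rGamma (c + of_nat (Suc n)) / pochhammer s (Suc n)"
      unfolding rc using nz[of "Suc n"] by (simp del: pochhammer_Suc of_nat_Suc)
    finally show "rGamma_series a n * rGamma_series b n / (rGamma_series c n * rGamma_series s n) * rGamma c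
       = pochhammer a (Suc n) * pochhammer b (Suc n) * rGamma (c + of_nat (Suc n)) / pochhammer s (Suc n)" .
  qed
  finally show ?thesis by (rule filterlim_sequentially_Suc[THEN iffD1])
qed

text \<open>Comparison with the binomial series of (1 - x)^(-s), whose coefficients (s)_n / n! grow
  like those of the hypergeometric series up to a constant factor.\<close>

lemma eval_hyp_reg_fps_at_1:
  fixes a b c :: complex and s :: real
  assumes "a + b = c + of_real s" "s > 0" "c \<notin> \<int>\<^sub>\<le>\<^sub>0"
  shows "((\<lambda>x. of_real ((1 - x) powr s) * eval_fps (hyp_reg_fps a b c) (of_real x))
            \<longlongrightarrow> rGamma a * rGamma b * Gamma (of_real s)) (at_left 1)"
proof -
  define V where "V x = (1 - x) powr (- s)" for x :: real
  define v where "v n = pochhammer s n / fact n" for n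
  define u where "u = fps_nth (hyp_reg_fps a b c)"
  have "of_real s \<notin> (\<int>\<^sub>\<le>\<^sub>0 :: complex set)"
    using assms(2) by (auto elim!: nonpos_Ints_cases simp: complex_eq_iff)
  from pochhammer_ratio_limit[OF assms(1) this assms(3)]
  have "(\<lambda>n. u n / of_real (v n)) \<longlonglongrightarrow> rGamma a * rGamma b * Gamma (of_real s)"
    by (simp add: u_def v_def hyp_reg_fps_def pochhammer_of_real)
  hence "((\<lambda>x. (\<Sum>n. u n * of_real x ^ n) / of_real (V x)) \<longlongrightarrow> rGamma a * rGamma b * Gamma (of_real s)) (at_left 1)"
  proof (rule abel_ratio_limit[rotated])
    show "v n > 0" for n using assms(2) by (simp add: v_def pochhammer_pos)
    show "(\<lambda>n. v n * x ^ n) sums V x" if "0 < x" "x < 1" for x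
    proof -
      have "((- s) gchoose n) * (- x) ^ n = v n * x ^ n" for n
        by (simp add: gbinomial_pochhammer v_def power_minus[of x] mult.assoc)
      thus ?thesis using gen_binomial_real[of "- x" "- s"] that by (simp add: V_def)
    qed
    show "summable (\<lambda>n. norm (u n * of_real x ^ n))" if "0 < x" "x < 1" for x
      unfolding u_def using that by (intro norm_summable_fps hyp_reg_fps_conv_radius') auto
    show "filterlim V at_top (at_left 1)"
      unfolding V_def using assms(2) by real_asymp
  qed
  moreover have "eventually (\<lambda>x. x \<in> {0<..<1::real}) (at_left 1)"
    by (rule eventually_at_left_real) simp
  hence "eventually (\<lambda>x. (\<Sum>n. u n * of_real x ^ n) / of_real (V x) =
      of_real ((1 - x) powr s) * eval_fps (hyp_reg_fps a b c) (of_real x)) (at_left 1)"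
    by eventually_elim (simp add: V_def powr_minus eval_fps_def u_def field_simps)
  ultimately show ?thesis by (rule Lim_transform_eventually)
qed

section \<open>The hypergeometric equation on a half disc\<close>

text \<open>The common domain of the two sides of the connection formula: |w| < 1 makes the
  Frobenius series converge, and Re w > 0 makes |(1 - w) / (1 + w)| < 1, as well as the power of w
  holomorphic. Convexity gives constancy from a vanishing derivative.\<close>

definition half_disc :: "complex set" where "half_disc = {w. Re w > 0 \<and> norm w < 1}"

lemma half_disc_simps:
  assumes "w \<in> half_disc"
  shows "w \<noteq> 0" "1 - w \<noteq> 0" "1 + w \<noteq> 0" "w \<notin> \<real>\<^sub>\<le>\<^sub>0" "1 - w \<notin> \<real>\<^sub>\<le>\<^sub>0" "1 + w \<notin> \<real>\<^sub>\<le>\<^sub>0" "norm w < 1"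
proof -
  have w: "Re w > 0" "norm w < 1" using assms by (auto simp: half_disc_def)
  hence "Re w < 1" using complex_Re_le_cmod[of w] by linarith
  with w show "w \<noteq> 0" "1 - w \<noteq> 0" "1 + w \<noteq> 0" "w \<notin> \<real>\<^sub>\<le>\<^sub>0" "1 - w \<notin> \<real>\<^sub>\<le>\<^sub>0" "1 + w \<notin> \<real>\<^sub>\<le>\<^sub>0" "norm w < 1"
    by (auto simp: complex_nonpos_Reals_iff complex_eq_iff)
qed

lemma convex_half_disc: "convex half_disc"
proof -
  have "half_disc = {w. Re w > 0} \<inter> ball 0 1" by (auto simp: half_disc_def)
  show ?thesis unfolding \<open>half_disc = _\<close> by (intro convex_Int convex_halfspace_Re_gt convex_ball)
qed

lemma of_real_in_half_disc [simp]: "of_real x \<in> half_disc \<longleftrightarrow> 0 < x \<and> x < 1"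
  by (auto simp: half_disc_def)

lemma has_field_derivative_powr_const:
  assumes "(w::complex) \<notin> \<real>\<^sub>\<le>\<^sub>0"
  shows "((\<lambda>w. w powr c) has_field_derivative w powr c * (c / w)) (at w within A)"
proof -
  have "w \<noteq> 0" using assms by (intro notI) simp
  thus ?thesis using assms by (auto intro!: derivative_eq_intros simp: powr_diff)
qed

text \<open>The derivatives are explicit arguments, so that Wronskians and pullbacks can be handled
  by algebra on named functions.\<close>

definition hyp_solution ::
    "complex \<Rightarrow> complex \<Rightarrow> complex \<Rightarrow> (complex \<Rightarrow> complex) \<Rightarrow> (complex \<Rightarrow> complex) \<Rightarrow> (complex \<Rightarrow> complex) \<Rightarrow> bool" where
  "hyp_solution a b c y y1 y2 \<longleftrightarrow>
     (\<forall>w\<in>half_disc. (y has_field_derivative y1 w) (at w) \<and> (y1 has_field_derivative y2 w) (at w) \<and>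
        w * (1 - w) * y2 w + (c - (a + b + 1) * w) * y1 w - a * b * y w = 0)"

lemma hyp_solution_reg:
  "hyp_solution a b c (eval_fps (hyp_reg_fps a b c)) (eval_fps (fps_deriv (hyp_reg_fps a b c)))
     (eval_fps (fps_deriv (fps_deriv (hyp_reg_fps a b c))))"
  unfolding hyp_solution_def
  using hyp_reg_fps_has_derivative[of _ a b c UNIV] eval_hyp_reg_fps_ode[of _ a b c] half_disc_simps(7)
  by blast

text \<open>Abel's identity: the equation divided by w (1 - w) has first-order coefficient c / w -
  (a + b + 1 - c) / (1 - w), and the weight is the exponential of its primitive.\<close>

lemma hyp_wronskian_constant:
  assumes y: "hyp_solution a b c y y1 y2" and z: "hyp_solution a b c z z1 z2"
  shows "\<exists>k. \<forall>w\<in>half_disc. w powr c * (1 - w) powr (a + b + 1 - c) * (y w * z1 w - y1 w * z w) = k"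
proof (rule has_field_derivative_zero_constant[OF convex_half_disc])
  fix w assume w: "w \<in> half_disc"
  note w' = half_disc_simps[OF w]
  have ode: "w * (1 - w) * y2 w + (c - (a + b + 1) * w) * y1 w - a * b * y w = 0"
    "w * (1 - w) * z2 w + (c - (a + b + 1) * w) * z1 w - a * b * z w = 0"
    and d: "(y has_field_derivative y1 w) (at w within half_disc)" "(y1 has_field_derivative y2 w) (at w within half_disc)"
     "(z has_field_derivative z1 w) (at w within half_disc)" "(z1 has_field_derivative z2 w) (at w within half_disc)"
    using y z w by (auto simp: hyp_solution_def has_field_derivative_at_within)
  define \<rho> where "\<rho> = w powr c * (1 - w) powr (a + b + 1 - c)"
  have "((\<lambda>w. w powr c * (1 - w) powr e) has_field_derivative
      w powr c * (1 - w) powr e * (c / w - e / (1 - w))) (at w within half_disc)" for e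
  proof -
    have "((\<lambda>w. (1 - w) powr e) has_field_derivative
        (1 - w) powr e * (e / (1 - w)) * (- 1)) (at w within half_disc)"
      by (rule DERIV_chain2[where g = "\<lambda>w. 1 - w"], rule has_field_derivative_powr_const)
         (use w' in \<open>auto intro!: derivative_eq_intros\<close>)
    from DERIV_mult[OF has_field_derivative_powr_const[OF w'(4), of c half_disc] this]
    show ?thesis by (rule DERIV_cong) (simp add: algebra_simps)
  qed
  from DERIV_mult[OF this[of "a + b + 1 - c", folded \<rho>_def] DERIV_diff[OF DERIV_mult[OF d(1,4)] DERIV_mult[OF d(2,3)]]]
  have "((\<lambda>w. w powr c * (1 - w) powr (a + b + 1 - c) * (y w * z1 w - y1 w * z w)) has_field_derivative
      \<rho> * (c / w - (a + b + 1 - c) / (1 - w)) * (y w * z1 w - y1 w * z w)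
      + \<rho> * (y w * z2 w - y2 w * z w)) (at w within half_disc)"
    by (rule DERIV_cong) (simp add: \<rho>_def algebra_simps)
  moreover have "(c / w - (a + b + 1 - c) / (1 - w)) * (y w * z1 w - y1 w * z w) + (y w * z2 w - y2 w * z w) = 0"
  proof -
    have "w * (1 - w) * ((c / w - (a + b + 1 - c) / (1 - w)) * (y w * z1 w - y1 w * z w) + (y w * z2 w - y2 w * z w))
      = (c * (1 - w) - (a + b + 1 - c) * w) * (y w * z1 w - y1 w * z w)
       + (y w * (w * (1 - w) * z2 w) - w * (1 - w) * y2 w * z w)"
      using w' by (simp add: divide_simps) (simp add: algebra_simps)
    also have "\<dots> = 0" using ode by algebra
    finally show ?thesis using w' by simp
  qed
  ultimately show "((\<lambda>w. w powr c * (1 - w) powr (a + b + 1 - c) * (y w * z1 w - y1 w * z w)) has_field_derivative 0) (at w within half_disc)"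
    by (metis (no_types, lifting) distrib_left mult.assoc mult_zero_right)
qed

text \<open>Cramer's rule in the form W(F,G) L = W(L,G) F + W(F,L) G; after weighting, all three
  Wronskians are constants.\<close>

lemma hyp_solutions_dependent:
  assumes L: "hyp_solution a b c L L1 L2" and F: "hyp_solution a b c F F1 F2" and G: "hyp_solution a b c G G1 G2"
    and k: "\<exists>w\<in>half_disc. w powr c * (1 - w) powr (a + b + 1 - c) * (F w * G1 w - F1 w * G w) \<noteq> 0"
  obtains C D where "\<And>w. w \<in> half_disc \<Longrightarrow> L w = C * F w + D * G w"
proof -
  define \<rho> where "\<rho> w = w powr c * (1 - w) powr (a + b + 1 - c)" for w
  obtain k1 where k1: "\<And>w. w \<in> half_disc \<Longrightarrow> \<rho> w * (F w * G1 w - F1 w * G w) = k1"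
    using hyp_wronskian_constant[OF F G] by (auto simp: \<rho>_def)
  obtain k2 where k2: "\<And>w. w \<in> half_disc \<Longrightarrow> \<rho> w * (L w * G1 w - L1 w * G w) = k2"
    using hyp_wronskian_constant[OF L G] by (auto simp: \<rho>_def)
  obtain k3 where k3: "\<And>w. w \<in> half_disc \<Longrightarrow> \<rho> w * (F w * L1 w - F1 w * L w) = k3"
    using hyp_wronskian_constant[OF F L] by (auto simp: \<rho>_def)
  have "k1 \<noteq> 0" using k k1 by (force simp: \<rho>_def)
  have "L w = k2 / k1 * F w + k3 / k1 * G w" if "w \<in> half_disc" for w
  proof -
    have "k1 * L w = k2 * F w + k3 * G w"
      unfolding k1[OF that, symmetric] k2[OF that, symmetric] k3[OF that, symmetric]
      by (simp add: algebra_simps)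
    thus ?thesis using \<open>k1 \<noteq> 0\<close> by (simp add: field_simps)
  qed
  thus ?thesis by (rule that)
qed

text \<open>The factor w^m exchanges the exponents 0 and 1 - c at the origin. It serves twice: for
  the second Frobenius solution and for the power of w in the Legendre function.\<close>

lemma hyp_solution_shift:
  assumes "hyp_solution a b (1 + m) y y1 y2"
  shows "hyp_solution (a - m) (b - m) (1 - m) (\<lambda>w. w powr m * y w) (\<lambda>w. w powr m * (y1 w + m / w * y w))
     (\<lambda>w. w powr m * (y2 w + 2 * m / w * y1 w + m * (m - 1) / w^2 * y w))"
  unfolding hyp_solution_def
proof (intro ballI conjI)
  fix w assume w: "w \<in> half_disc"
  note w' = half_disc_simps[OF w]
  have ode: "w * (1 - w) * y2 w + (1 + m - (a + b + 1) * w) * y1 w - a * b * y w = 0"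
    and d: "(y has_field_derivative y1 w) (at w)" "(y1 has_field_derivative y2 w) (at w)"
    using assms w by (auto simp: hyp_solution_def)
  have dp: "((\<lambda>w. w powr m) has_field_derivative w powr m * (m / w)) (at w)"
    by (rule has_field_derivative_powr_const[OF w'(4)])
  have dm: "((\<lambda>w. m / w) has_field_derivative - m / w^2) (at w)"
    using w' by (auto intro!: derivative_eq_intros simp: power2_eq_square)
  show "((\<lambda>w. w powr m * y w) has_field_derivative w powr m * (y1 w + m / w * y w)) (at w)"
    by (rule derivative_eq_intros dp d refl)+ (simp add: algebra_simps)
  show "((\<lambda>w. w powr m * (y1 w + m / w * y w)) has_field_derivative
     w powr m * (y2 w + 2 * m / w * y1 w + m * (m - 1) / w^2 * y w)) (at w)"
    by (rule derivative_eq_intros dp dm d refl)+ (simp add: power2_eq_square algebra_simps diff_divide_distrib)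
  have "w * (1 - w) * (y2 w + 2 * m / w * y1 w + m * (m - 1) / w^2 * y w) +
     (1 - m - (a - m + (b - m) + 1) * w) * (y1 w + m / w * y w) - (a - m) * (b - m) * y w =
     w * (1 - w) * y2 w + (1 + m - (a + b + 1) * w) * y1 w - a * b * y w"
    using w' by (simp add: divide_simps power2_eq_square) (simp add: algebra_simps)
  also have "\<dots> = 0" by (rule ode)
  finally have eq: "w powr m * (w * (1 - w) * (y2 w + 2 * m / w * y1 w + m * (m - 1) / w^2 * y w) +
     (1 - m - (a - m + (b - m) + 1) * w) * (y1 w + m / w * y w) - (a - m) * (b - m) * y w) = 0" by simp
  have factor: "X * (P * A) + Y * (P * B) - Z * (P * C) = P * (X * A + Y * B - Z * C)" for X Y Z P A B C :: complex
    by (simp add: algebra_simps)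
  from eq show "w * (1 - w) * (w powr m * (y2 w + 2 * m / w * y1 w + m * (m - 1) / w^2 * y w)) +
     (1 - m - (a - m + (b - m) + 1) * w) * (w powr m * (y1 w + m / w * y w)) - (a - m) * (b - m) * (w powr m * y w) = 0"
    unfolding factor .
qed

section \<open>Quadratic transformation to the argument of the Legendre function\<close>

lemma one_minus_koebe: "1 + t \<noteq> 0 \<Longrightarrow> 1 - koebe t = ((1 - t) / (1 + t))^2"
  by (simp add: koebe_def divide_simps power2_eq_square) (simp add: algebra_simps)

lemma norm_one_minus_koebe:
  assumes "w \<in> half_disc"
  shows "norm (1 - koebe w) < 1"
proof -
  have "Re w > 0" using assms by (simp add: half_disc_def)
  hence "norm (1 - w) < norm (1 + w)"
    unfolding cmod_def by (intro real_sqrt_less_mono) (simp add: power2_eq_square algebra_simps)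
  hence "norm ((1 - w) / (1 + w)) < 1"
    using half_disc_simps(3)[OF assms] by (simp add: norm_divide divide_simps)
  thus ?thesis
    unfolding one_minus_koebe[OF half_disc_simps(3)[OF assms]] norm_power
    by (simp add: power_less_one_iff)
qed

text \<open>
  Up to the substitution \<open>v \<mapsto> 1 - v\<close>, the pullback that continues the series also is the quadratic
  transformation needed for the Legendre function: when \<open>b = a + 1/2\<close>, a factor \<open>1 + w\<close> cancels and the
  singularity at \<open>-1\<close> disappears.
\<close>

lemma hyp_solution_koebe_pull:
  fixes a c :: complex
  defines "f \<equiv> hyp_reg_fps a (a + 1/2) (2 * a + 3/2 - c)"
  defines "g \<equiv> (\<lambda>v. eval_fps f (1 - v))"
  defines "g1 \<equiv> (\<lambda>v. - eval_fps (fps_deriv f) (1 - v))"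
  defines "g2 \<equiv> (\<lambda>v. eval_fps (fps_deriv (fps_deriv f)) (1 - v))"
  shows "hyp_solution (2 * a) (2 * a + 1 - c) c (koebe_pull a g) (koebe_pull1 a g g1) (koebe_pull2 a g g1 g2)"
  unfolding hyp_solution_def
proof (intro ballI conjI)
  fix w assume w: "w \<in> half_disc"
  note w' = half_disc_simps[OF w]
  define v where "v = koebe w"
  have v: "norm (1 - v) < 1" unfolding v_def by (rule norm_one_minus_koebe[OF w])
  have dv: "((\<lambda>v. 1 - v) has_field_derivative - 1) (at v)"
    by (auto intro!: derivative_eq_intros)
  have "(g has_field_derivative g1 v) (at v)" "(g1 has_field_derivative g2 v) (at v)"
    unfolding g_def g1_def g2_def f_def
    using DERIV_chain2[where g = "\<lambda>v. 1 - v", OF hyp_reg_fps_has_derivative(1)[OF v] dv]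
      DERIV_minus[OF DERIV_chain2[where g = "\<lambda>v. 1 - v", OF hyp_reg_fps_has_derivative(2)[OF v] dv]]
    by simp_all
  thus "(koebe_pull a g has_field_derivative koebe_pull1 a g g1 w) (at w)"
    "(koebe_pull1 a g g1 has_field_derivative koebe_pull2 a g g1 g2 w) (at w)"
    unfolding v_def using koebe_pull_has_derivative[OF w'(6), where g = g and ?g1.0 = g1 and ?g2.0 = g2] by blast+
  \<comment> \<open>The hypergeometric equation is preserved by v -> 1 - v when c is replaced by a +
    b + 1 - c; for b = a + 1/2 this explains the parameter 2a + 3/2 - c of \<open>f\<close>.\<close>
  have "v * (1 - v) * g2 v + (c - (a + (a + 1/2) + 1) * v) * g1 v - a * (a + 1/2) * g v = 0"
  proof -
    have "v * (1 - v) * g2 v + (c - (a + (a + 1/2) + 1) * v) * g1 v - a * (a + 1/2) * g v =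
      (1 - v) * (1 - (1 - v)) * eval_fps (fps_deriv (fps_deriv f)) (1 - v) +
      (2 * a + 3/2 - c - (a + (a + 1/2) + 1) * (1 - v)) * eval_fps (fps_deriv f) (1 - v) -
      a * (a + 1/2) * eval_fps f (1 - v)"
      by (simp add: g_def g1_def g2_def field_simps)
    also have "\<dots> = 0" unfolding f_def by (rule eval_hyp_reg_fps_ode[OF v])
    finally show ?thesis .
  qed
  from koebe_pull_ode[OF w'(3), of g2 c a "a + 1/2" g1 g, folded v_def, OF this]
  have "(1 + w) * (w * (1 - w) * koebe_pull2 a g g1 g2 w + (c - (2 * a + (2 * a + 1 - c) + 1) * w) * koebe_pull1 a g g1 w -
      2 * a * (2 * a + 1 - c) * koebe_pull a g w) = 0"
    by (simp add: power2_eq_square algebra_simps)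
  thus "w * (1 - w) * koebe_pull2 a g g1 g2 w + (c - (2 * a + (2 * a + 1 - c) + 1) * w) * koebe_pull1 a g g1 w -
      2 * a * (2 * a + 1 - c) * koebe_pull a g w = 0" using w' by simp
qed

section \<open>The connection formula\<close>

lemma hyp_reg_fps_commute: "hyp_reg_fps a b c = hyp_reg_fps b a c"
  by (simp add: hyp_reg_fps_def mult_ac)

lemma eval_hyp_reg_fps_at_0:
  "((\<lambda>x. eval_fps (hyp_reg_fps a b c) (of_real x)) \<longlongrightarrow> rGamma c) (at_right 0)"
proof -
  have "isCont (eval_fps (hyp_reg_fps a b c)) 0"
    using hyp_reg_fps_has_derivative(1)[of 0 a b c UNIV] by (auto intro: DERIV_isCont)
  hence "((\<lambda>x. eval_fps (hyp_reg_fps a b c) (of_real x)) \<longlongrightarrow> eval_fps (hyp_reg_fps a b c) 0) (at_right 0)"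
    by (rule isCont_tendsto_compose) (auto intro!: tendsto_eq_intros)
  thus ?thesis by (simp add: eval_fps_at_0)
qed

lemma eval_hyp_reg_fps_deriv_bounded_at_0:
  "((\<lambda>x. of_real x * eval_fps (fps_deriv (hyp_reg_fps a b c)) (of_real x)) \<longlongrightarrow> 0) (at_right 0)"
proof -
  have "isCont (eval_fps (fps_deriv (hyp_reg_fps a b c))) 0"
    using hyp_reg_fps_has_derivative(2)[of 0 a b c UNIV] by (auto intro: DERIV_isCont)
  hence "((\<lambda>x. eval_fps (fps_deriv (hyp_reg_fps a b c)) (of_real x)) \<longlongrightarrow> eval_fps (fps_deriv (hyp_reg_fps a b c)) 0) (at_right 0)"
    by (rule isCont_tendsto_compose) (auto intro!: tendsto_eq_intros)
  moreover have "((\<lambda>x. of_real x :: complex) \<longlongrightarrow> 0) (at_right 0)"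
    by (auto intro!: tendsto_eq_intros)
  ultimately show ?thesis using tendsto_mult by fastforce
qed

lemma powr_at_right_0:
  assumes "m > 0"
  shows "((\<lambda>x. of_real x powr of_real m :: complex) \<longlongrightarrow> 0) (at_right 0)"
proof -
  have "((\<lambda>x. of_real (x powr m) :: complex) \<longlongrightarrow> of_real 0) (at_right 0)"
    using assms by (intro tendsto_of_real) real_asymp
  moreover have "eventually (\<lambda>x. x \<in> {0<..<1::real}) (at_right 0)"
    by (rule eventually_at_right_real) simp
  hence "eventually (\<lambda>x. (of_real (x powr m) :: complex) = of_real x powr of_real m) (at_right 0)"
    by eventually_elim (simp add: powr_of_real)
  ultimately show ?thesis by (simp add: tendsto_cong)
qed

text \<open>The powers of w in the weighted Wronskian combine to a single factor w, so its limit at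
  0 is \<mu> / (Gamma(1 - \<mu>) Gamma(1 + \<mu>)), which is nonzero for 0 < \<mu> < 1.\<close>

lemma frobenius_wronskian_nonzero:
  fixes \<mu> a b a' b' :: complex and m :: real
  assumes m: "0 < m" "m < 1" "\<mu> = of_real m"
  defines "F \<equiv> hyp_reg_fps a b (1 - \<mu>)" and "G \<equiv> hyp_reg_fps a' b' (1 + \<mu>)"
  shows "\<exists>w\<in>half_disc. w powr (1 - \<mu>) * (1 - w) powr e *
     (eval_fps F w * (w powr \<mu> * (eval_fps (fps_deriv G) w + \<mu> / w * eval_fps G w))
      - eval_fps (fps_deriv F) w * (w powr \<mu> * eval_fps G w)) \<noteq> 0"
proof (rule ccontr)
  assume "\<not> ?thesis"
  hence zero: "w powr (1 - \<mu>) * (1 - w) powr e *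
     (eval_fps F w * (w powr \<mu> * (eval_fps (fps_deriv G) w + \<mu> / w * eval_fps G w))
      - eval_fps (fps_deriv F) w * (w powr \<mu> * eval_fps G w)) = 0" if "w \<in> half_disc" for w
    using that by blast
  have nonpos: "1 - \<mu> \<notin> \<int>\<^sub>\<le>\<^sub>0" "1 + \<mu> \<notin> \<int>\<^sub>\<le>\<^sub>0"
    using m by (auto elim!: nonpos_Ints_cases simp: complex_eq_iff)
  define h where "h w = eval_fps F w * (w * eval_fps (fps_deriv G) w + \<mu> * eval_fps G w)
      - w * eval_fps (fps_deriv F) w * eval_fps G w" for w
  have "h (of_real x) = 0" if "x \<in> {0<..<1}" for x
  proof -
    define w where "w = complex_of_real x"
    have w: "w \<in> half_disc" using that by (simp add: w_def)
    note w' = half_disc_simps[OF w]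
    have "h w = w * (eval_fps F w * (eval_fps (fps_deriv G) w + \<mu> / w * eval_fps G w)
      - eval_fps (fps_deriv F) w * eval_fps G w)"
      using w' by (simp add: h_def algebra_simps)
    moreover have "(eval_fps F w * (eval_fps (fps_deriv G) w + \<mu> / w * eval_fps G w)
      - eval_fps (fps_deriv F) w * eval_fps G w) * (w powr (1 - \<mu>) * (1 - w) powr e * w powr \<mu>) = 0"
      using zero[OF w] by (simp add: algebra_simps)
    moreover have "w powr (1 - \<mu>) * (1 - w) powr e * w powr \<mu> \<noteq> 0"
      using w' by simp
    ultimately show ?thesis by (simp add: w_def)
  qed
  moreover have "eventually (\<lambda>x. x \<in> {0<..<1::real}) (at_right 0)"
    by (rule eventually_at_right_real) simp
  ultimately have "eventually (\<lambda>x. h (of_real x) = 0) (at_right 0)"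
    by (metis (mono_tags, lifting) eventually_mono)
  hence "((\<lambda>x. h (of_real x)) \<longlongrightarrow> 0) (at_right 0)"
    by (simp add: tendsto_cong)
  moreover have "((\<lambda>x. h (of_real x)) \<longlongrightarrow> rGamma (1 - \<mu>) * (0 + \<mu> * rGamma (1 + \<mu>)) - 0 * rGamma (1 + \<mu>)) (at_right 0)"
    unfolding h_def F_def G_def
    by (intro tendsto_intros eval_hyp_reg_fps_at_0 eval_hyp_reg_fps_deriv_bounded_at_0)
  ultimately have "rGamma (1 - \<mu>) * (0 + \<mu> * rGamma (1 + \<mu>)) - 0 * rGamma (1 + \<mu>) = 0"
    by (intro tendsto_unique) auto
  thus False using m nonpos by (auto simp: rGamma_eq_zero_iff)
qed

lemma connection_real_aux:
  fixes m n :: real and \<mu> \<nu> :: complex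
  assumes m: "0 < m" "m < 1" "\<mu> = of_real m" and n: "0 < n" "\<nu> = of_real n"
  defines "L \<equiv> (\<lambda>w. w powr \<mu> * ((1 + w) powr (- (\<nu> + \<mu> + 1)) *
      eval_fps (hyp_reg_fps ((\<nu> + \<mu> + 1) / 2) ((\<nu> + \<mu> + 2) / 2) (\<nu> + 3/2)) (1 - koebe w)))"
  defines "F \<equiv> eval_fps (hyp_reg_fps (\<nu> + 1) (\<nu> - \<mu> + 1) (1 - \<mu>))"
  defines "G \<equiv> eval_fps (hyp_reg_fps (\<nu> + 1) (\<nu> + \<mu> + 1) (1 + \<mu>))"
  obtains K where "K * rGamma (\<nu> + \<mu> + 1) * rGamma (1 - \<mu>) =
      of_real (4 powr (- m)) * (rGamma ((\<nu> + \<mu> + 1) / 2) * rGamma ((\<nu> + \<mu> + 2) / 2) * Gamma \<mu>)"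
    "\<And>w. w \<in> half_disc \<Longrightarrow> L w = K * (rGamma (\<nu> + \<mu> + 1) * F w - rGamma (\<nu> - \<mu> + 1) * (w powr \<mu> * G w))"
proof -
  define \<alpha> where "\<alpha> = (\<nu> + \<mu> + 1) / 2"
  define fQ where "fQ = hyp_reg_fps \<alpha> (\<alpha> + 1/2) (\<nu> + 3/2)"
  define GG where "GG = hyp_reg_fps (\<nu> + \<mu> + 1) (\<nu> + 1) (1 + \<mu>)"
  define FF where "FF = hyp_reg_fps (\<nu> + 1) (\<nu> - \<mu> + 1) (1 - \<mu>)"
  have \<alpha>: "2 * \<alpha> = \<nu> + \<mu> + 1" "(\<nu> + \<mu> + 2) / 2 = \<alpha> + 1/2" by (simp_all add: \<alpha>_def field_simps)
  have GGe: "G = eval_fps GG" by (simp add: G_def GG_def hyp_reg_fps_commute)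
  have FFe: "F = eval_fps FF" by (simp add: F_def FF_def)
  have L_eq: "L = (\<lambda>w. w powr \<mu> * koebe_pull \<alpha> (\<lambda>v. eval_fps fQ (1 - v)) w)"
    unfolding L_def koebe_pull_def fQ_def \<alpha>(2) \<alpha>_def[symmetric] by (simp add: \<alpha>(1))
  have pars: "\<nu> + \<mu> + 1 + 1 - (1 + \<mu>) = \<nu> + 1" "\<nu> + \<mu> + 1 + 3/2 - (1 + \<mu>) = \<nu> + 3/2"
    "\<nu> + \<mu> + 1 - \<mu> = \<nu> + 1" "\<nu> + 1 - \<mu> = \<nu> - \<mu> + 1" by simp_all
  have solG: "hyp_solution (\<nu> + 1) (\<nu> - \<mu> + 1) (1 - \<mu>) (\<lambda>w. w powr \<mu> * eval_fps GG w)
     (\<lambda>w. w powr \<mu> * (eval_fps (fps_deriv GG) w + \<mu> / w * eval_fps GG w))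
     (\<lambda>w. w powr \<mu> * (eval_fps (fps_deriv (fps_deriv GG)) w + 2 * \<mu> / w * eval_fps (fps_deriv GG) w + \<mu> * (\<mu> - 1) / w^2 * eval_fps GG w))"
    using hyp_solution_shift[OF hyp_solution_reg[of "\<nu> + \<mu> + 1" "\<nu> + 1" "1 + \<mu>"]]
    unfolding pars GG_def[symmetric] .
  \<comment> \<open>The quadratic transformation is taken at c = 1 + \<mu>; the shift by w^\<mu>
    then lands in the equation of the Frobenius solutions with c = 1 - \<mu>.\<close>
  obtain L1 L2 where solL: "hyp_solution (\<nu> + 1) (\<nu> - \<mu> + 1) (1 - \<mu>) L L1 L2"
    using hyp_solution_shift[OF hyp_solution_koebe_pull[of \<alpha> "1 + \<mu>", unfolded \<alpha>(1), unfolded pars, folded fQ_def]]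
    unfolding L_eq pars by blast
  obtain C D where CD: "\<And>w. w \<in> half_disc \<Longrightarrow> L w = C * eval_fps FF w + D * (w powr \<mu> * eval_fps GG w)"
  proof (rule hyp_solutions_dependent[OF solL hyp_solution_reg solG])
    show "\<exists>w\<in>half_disc. w powr (1 - \<mu>) * (1 - w) powr (\<nu> + 1 + (\<nu> - \<mu> + 1) + 1 - (1 - \<mu>)) *
      (eval_fps (hyp_reg_fps (\<nu> + 1) (\<nu> - \<mu> + 1) (1 - \<mu>)) w *
       (w powr \<mu> * (eval_fps (fps_deriv GG) w + \<mu> / w * eval_fps GG w)) -
       eval_fps (fps_deriv (hyp_reg_fps (\<nu> + 1) (\<nu> - \<mu> + 1) (1 - \<mu>))) w * (w powr \<mu> * eval_fps GG w)) \<noteq> 0"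
      unfolding GG_def by (rule frobenius_wronskian_nonzero[OF m])
  qed (auto simp: FF_def intro: that)
  \<comment> \<open>The factor x^\<mu> is split as ((1 + x)^2 / 4)^\<mu> (1 - v)^\<mu> with v = 1 -
    koebe x, to match the normalization in \<open>eval_hyp_reg_fps_at_1\<close> as v tends to
    1.\<close>
  have L_real: "L (of_real x) = of_real (((1 + x)^2 / 4) powr m) * of_real (1 + x) powr (- 2 * \<alpha>) *
      (of_real ((1 - (1 - 4 * x / (1 + x)^2)) powr m) * eval_fps fQ (of_real (1 - 4 * x / (1 + x)^2)))"
    if "x \<in> {0<..<1}" for x
  proof -
    have "((1 + x)^2 / 4) powr m * (1 - (1 - 4 * x / (1 + x)^2)) powr m = ((1 + x)^2 / 4 * (4 * x / (1 + x)^2)) powr m"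
      using that by (subst powr_mult) auto
    also have "(1 + x)^2 / 4 * (4 * x / (1 + x)^2) = x" using that by simp
    finally have "of_real (((1 + x)^2 / 4) powr m) * of_real ((1 - (1 - 4 * x / (1 + x)^2)) powr m) = (of_real x powr \<mu> :: complex)"
      using that m(3) by (simp add: powr_of_real flip: of_real_mult)
    thus ?thesis unfolding L_eq koebe_pull_def koebe_def by (simp add: mult_ac)
  qed
  have ev0: "eventually (\<lambda>x. x \<in> {0<..<1::real}) (at_right 0)"
    by (rule eventually_at_right_real) simp
  have ev1: "eventually (\<lambda>x. x \<in> {0<..<1::real}) (at_left 1)"
    by (rule eventually_at_left_real) simp
  have npi: "of_real r \<notin> (\<int>\<^sub>\<le>\<^sub>0 :: complex set)" if "r > 0" for r :: real
    using that by (auto elim!: nonpos_Ints_cases simp: complex_eq_iff)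
  have c1: "\<nu> + 3/2 \<notin> \<int>\<^sub>\<le>\<^sub>0" using npi[of "n + 3/2"] n by simp
  have c2: "1 - \<mu> \<notin> \<int>\<^sub>\<le>\<^sub>0" using npi[of "1 - m"] m by simp
  have c3: "1 + \<mu> \<notin> \<int>\<^sub>\<le>\<^sub>0" using npi[of "1 + m"] m by simp
  have c4: "\<nu> + \<mu> + 1 \<notin> \<int>\<^sub>\<le>\<^sub>0" using npi[of "n + m + 1"] m n by simp
  have c5: "\<nu> + 1 \<notin> \<int>\<^sub>\<le>\<^sub>0" using npi[of "n + 1"] m n by simp

  \<comment> \<open>\<open>w \<rightarrow> 0\<close> determines \<open>C\<close>.\<close>
  define K0 where "K0 = rGamma \<alpha> * rGamma (\<alpha> + 1/2) * Gamma (of_real m)"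
  have "((\<lambda>x. of_real ((1 - x) powr m) * eval_fps fQ (of_real x)) \<longlongrightarrow> K0) (at_left 1)"
    unfolding fQ_def K0_def using m n c1
    by (intro eval_hyp_reg_fps_at_1) (auto simp: \<alpha>_def field_simps)
  moreover have "filterlim (\<lambda>x::real. 1 - 4 * x / (1 + x)^2) (at_left 1) (at_right 0)"
    by real_asymp
  ultimately have "((\<lambda>x. of_real ((1 - (1 - 4 * x / (1 + x)^2)) powr m) * eval_fps fQ (of_real (1 - 4 * x / (1 + x)^2))) \<longlongrightarrow> K0) (at_right 0)"
    by (rule filterlim_compose)
  moreover have "((\<lambda>x. of_real (((1 + x)^2 / 4) powr m) :: complex) \<longlongrightarrow> of_real (4 powr (- m))) (at_right 0)"
    by (intro tendsto_of_real) (auto intro!: tendsto_eq_intros simp: powr_minus powr_divide divide_simps)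
  moreover have "((\<lambda>x. of_real (1 + x) powr (- 2 * \<alpha>)) \<longlongrightarrow> of_real (1 + 0) powr (- 2 * \<alpha>)) (at_right 0)"
    by (intro tendsto_intros) (auto simp: complex_nonpos_Reals_iff)
  ultimately have "((\<lambda>x. of_real (((1 + x)^2 / 4) powr m) * of_real (1 + x) powr (- 2 * \<alpha>) *
      (of_real ((1 - (1 - 4 * x / (1 + x)^2)) powr m) * eval_fps fQ (of_real (1 - 4 * x / (1 + x)^2)))) \<longlongrightarrow>
      of_real (4 powr (- m)) * of_real (1 + 0) powr (- 2 * \<alpha>) * K0) (at_right 0)"
    by (intro tendsto_mult)
  moreover have "eventually (\<lambda>x. of_real (((1 + x)^2 / 4) powr m) * of_real (1 + x) powr (- 2 * \<alpha>) *
      (of_real ((1 - (1 - 4 * x / (1 + x)^2)) powr m) * eval_fps fQ (of_real (1 - 4 * x / (1 + x)^2))) =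
      C * eval_fps FF (of_real x) + D * (of_real x powr \<mu> * eval_fps GG (of_real x))) (at_right 0)"
    using ev0 by eventually_elim (simp only: L_real[symmetric], rule CD, simp)
  ultimately have "((\<lambda>x. C * eval_fps FF (of_real x) + D * (of_real x powr \<mu> * eval_fps GG (of_real x))) \<longlongrightarrow>
      of_real (4 powr (- m)) * of_real (1 + 0) powr (- 2 * \<alpha>) * K0) (at_right 0)"
    by (rule Lim_transform_eventually)
  moreover have "((\<lambda>x. C * eval_fps FF (of_real x) + D * (of_real x powr \<mu> * eval_fps GG (of_real x))) \<longlongrightarrow>
      C * rGamma (1 - \<mu>) + D * (0 * rGamma (1 + \<mu>))) (at_right 0)"
    unfolding FF_def GG_def m(3)
    by (intro tendsto_intros eval_hyp_reg_fps_at_0 powr_at_right_0 m)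
  ultimately have C: "C * rGamma (1 - \<mu>) = of_real (4 powr (- m)) * K0"
    using tendsto_unique[of "at_right (0::real)"] by fastforce

  \<comment> \<open>\<open>w \<rightarrow> 1\<close> determines \<open>D\<close>: only the combination \<open>C F1 + D w^\<mu> F2\<close> stays bounded.\<close>
  define s where "s = 2 * n + 1"
  have s: "s > 0" using n by (simp add: s_def)
  \<comment> \<open>Both Frobenius series have the same excess a + b - c = 2 \<nu> + 1, so one
    factor (1 - x)^s tames both.\<close>
  have lF: "((\<lambda>x. of_real ((1 - x) powr s) * eval_fps FF (of_real x)) \<longlongrightarrow>
      rGamma (\<nu> + 1) * rGamma (\<nu> - \<mu> + 1) * Gamma (of_real s)) (at_left 1)"
    unfolding FF_def using c2 s by (intro eval_hyp_reg_fps_at_1) (auto simp: s_def n)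
  have lG: "((\<lambda>x. of_real ((1 - x) powr s) * eval_fps GG (of_real x)) \<longlongrightarrow>
      rGamma (\<nu> + \<mu> + 1) * rGamma (\<nu> + 1) * Gamma (of_real s)) (at_left 1)"
    unfolding GG_def using c3 s by (intro eval_hyp_reg_fps_at_1) (auto simp: s_def n)
  have lp: "((\<lambda>x. of_real x powr \<mu>) \<longlongrightarrow> of_real 1 powr \<mu>) (at_left 1)"
    by (intro tendsto_intros) (auto simp: complex_nonpos_Reals_iff)
  have "((\<lambda>x. C * (of_real ((1 - x) powr s) * eval_fps FF (of_real x)) +
      D * (of_real x powr \<mu> * (of_real ((1 - x) powr s) * eval_fps GG (of_real x)))) \<longlongrightarrow>
      C * (rGamma (\<nu> + 1) * rGamma (\<nu> - \<mu> + 1) * Gamma (of_real s)) +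
      D * (of_real 1 powr \<mu> * (rGamma (\<nu> + \<mu> + 1) * rGamma (\<nu> + 1) * Gamma (of_real s)))) (at_left 1)"
    by (intro tendsto_add tendsto_mult[OF tendsto_const lF] tendsto_mult[OF tendsto_const tendsto_mult[OF lp lG]])
  moreover have "eventually (\<lambda>x. C * (of_real ((1 - x) powr s) * eval_fps FF (of_real x)) +
      D * (of_real x powr \<mu> * (of_real ((1 - x) powr s) * eval_fps GG (of_real x))) =
      of_real ((1 - x) powr s) * L (of_real x)) (at_left 1)"
    using ev1 by eventually_elim (subst CD, simp, simp add: algebra_simps)
  ultimately have "((\<lambda>x. of_real ((1 - x) powr s) * L (of_real x)) \<longlongrightarrow>
      C * (rGamma (\<nu> + 1) * rGamma (\<nu> - \<mu> + 1) * Gamma (of_real s)) +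
      D * (of_real 1 powr \<mu> * (rGamma (\<nu> + \<mu> + 1) * rGamma (\<nu> + 1) * Gamma (of_real s)))) (at_left 1)"
    by (rule Lim_transform_eventually)
  moreover have "((\<lambda>x. of_real ((1 - x) powr s) * L (of_real x)) \<longlongrightarrow> of_real 0 * L 1) (at_left 1)"
  proof (intro tendsto_mult tendsto_of_real)
    show "((\<lambda>x. (1 - x) powr s) \<longlongrightarrow> 0) (at_left 1)" using s by real_asymp
    have "isCont koebe 1" unfolding koebe_def by (intro continuous_intros) auto
    \<comment> \<open>At w = 1 the series inside \<open>L\<close> is evaluated at its centre, hence
      \<open>L\<close> is continuous there.\<close>
    have q1: "1 - koebe 1 = 0" by (simp add: koebe_def)
    have "isCont (\<lambda>v. eval_fps fQ (1 - koebe v)) 1"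
    proof (rule isCont_o2[where g = "eval_fps fQ"])
      show "isCont (\<lambda>v. 1 - koebe v) 1" using \<open>isCont koebe 1\<close> by (intro continuous_intros)
      show "isCont (eval_fps fQ) (1 - koebe 1)" unfolding q1 fQ_def
        using hyp_reg_fps_has_derivative(1)[of 0 _ _ _ UNIV] by (auto intro: DERIV_isCont)
    qed
    hence "isCont L 1" unfolding L_eq koebe_pull_def
      by (intro continuous_intros) (auto simp: complex_nonpos_Reals_iff)
    thus "((\<lambda>x. L (of_real x)) \<longlongrightarrow> L 1) (at_left 1)"
      by (rule isCont_tendsto_compose) (auto intro!: tendsto_eq_intros)
  qed
  ultimately have "C * (rGamma (\<nu> + 1) * rGamma (\<nu> - \<mu> + 1) * Gamma (of_real s)) +
      D * (of_real 1 powr \<mu> * (rGamma (\<nu> + \<mu> + 1) * rGamma (\<nu> + 1) * Gamma (of_real s))) = of_real 0 * L 1"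
    by (intro tendsto_unique[of "at_left (1::real)"]) auto
  hence "(rGamma (\<nu> + 1) * Gamma (of_real s)) * (C * rGamma (\<nu> - \<mu> + 1) + D * rGamma (\<nu> + \<mu> + 1)) = 0"
    by (simp add: algebra_simps)
  moreover have "rGamma (\<nu> + 1) * Gamma (of_real s) \<noteq> 0"
    using c5 npi[OF s] by (simp add: rGamma_eq_zero_iff Gamma_eq_zero_iff)
  ultimately have D: "D * rGamma (\<nu> + \<mu> + 1) = - (C * rGamma (\<nu> - \<mu> + 1))"
    by (simp add: add_eq_0_iff2)

  have r: "rGamma (\<nu> + \<mu> + 1) \<noteq> 0" using c4 by (simp add: rGamma_eq_zero_iff)
  \<comment> \<open>The condition at 1 fixes only the ratio of C and D; \<open>K\<close> is the
    common factor that remains.\<close>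
  define K where "K = C / rGamma (\<nu> + \<mu> + 1)"
  have CK: "C = K * rGamma (\<nu> + \<mu> + 1)" "D = - (K * rGamma (\<nu> - \<mu> + 1))"
    using D r by (simp_all add: K_def field_simps)
  show ?thesis
  proof (rule that[of K])
    show "K * rGamma (\<nu> + \<mu> + 1) * rGamma (1 - \<mu>) =
      of_real (4 powr (- m)) * (rGamma ((\<nu> + \<mu> + 1) / 2) * rGamma ((\<nu> + \<mu> + 2) / 2) * Gamma \<mu>)"
      using C unfolding CK(1) K0_def \<alpha>(2) m(3)[symmetric] by (simp add: \<alpha>_def)
    show "L w = K * (rGamma (\<nu> + \<mu> + 1) * F w - rGamma (\<nu> - \<mu> + 1) * (w powr \<mu> * G w))" if "w \<in> half_disc" for w
      unfolding CD[OF that] CK FFe GGe by (simp add: algebra_simps)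
  qed
qed

text \<open>Elimination of K: duplication merges the two half-argument Gamma factors, reflection
  replaces Gamma(\<mu>) Gamma(1 - \<mu>). The sine is kept as a multiplier instead of a denominator,
  so that both sides are entire in the parameters.\<close>

lemma connection_real:
  fixes m n :: real and \<mu> \<nu> w :: complex
  assumes m: "0 < m" "m < 1" "\<mu> = of_real m" and n: "0 < n" "\<nu> = of_real n" and w: "w \<in> half_disc"
  shows "sin (of_real pi * \<mu>) * 2 powr \<mu> * (w powr \<mu> * ((1 + w) powr (- (\<nu> + \<mu> + 1)) *
      eval_fps (hyp_reg_fps ((\<nu> + \<mu> + 1) / 2) ((\<nu> + \<mu> + 2) / 2) (\<nu> + 3/2)) (1 - koebe w))) =
    of_real (sqrt pi) * 2 powr \<nu> *
     (rGamma (\<nu> + \<mu> + 1) * eval_fps (hyp_reg_fps (\<nu> + 1) (\<nu> - \<mu> + 1) (1 - \<mu>)) w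
      - rGamma (\<nu> - \<mu> + 1) * (w powr \<mu> * eval_fps (hyp_reg_fps (\<nu> + 1) (\<nu> + \<mu> + 1) (1 + \<mu>)) w))"
proof -
  define \<alpha> where "\<alpha> = (\<nu> + \<mu> + 1) / 2"
  have \<alpha>: "\<nu> + \<mu> + 1 = 2 * \<alpha>" "(\<nu> + \<mu> + 2) / 2 = \<alpha> + 1/2" by (simp_all add: \<alpha>_def field_simps)
  obtain K where K: "K * rGamma (\<nu> + \<mu> + 1) * rGamma (1 - \<mu>) =
      of_real (4 powr (- m)) * (rGamma ((\<nu> + \<mu> + 1) / 2) * rGamma ((\<nu> + \<mu> + 2) / 2) * Gamma \<mu>)"
    and eq: "\<And>w. w \<in> half_disc \<Longrightarrow> w powr \<mu> * ((1 + w) powr (- (\<nu> + \<mu> + 1)) *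
      eval_fps (hyp_reg_fps ((\<nu> + \<mu> + 1) / 2) ((\<nu> + \<mu> + 2) / 2) (\<nu> + 3/2)) (1 - koebe w))
      = K * (rGamma (\<nu> + \<mu> + 1) * eval_fps (hyp_reg_fps (\<nu> + 1) (\<nu> - \<mu> + 1) (1 - \<mu>)) w
      - rGamma (\<nu> - \<mu> + 1) * (w powr \<mu> * eval_fps (hyp_reg_fps (\<nu> + 1) (\<nu> + \<mu> + 1) (1 + \<mu>)) w))"
    using connection_real_aux[OF m n] by blast
  have npi: "of_real r \<notin> (\<int>\<^sub>\<le>\<^sub>0 :: complex set)" if "r > 0" for r :: real
    using that by (auto elim!: nonpos_Ints_cases simp: complex_eq_iff)
  have npis: "\<alpha> \<notin> \<int>\<^sub>\<le>\<^sub>0" "\<alpha> + 1/2 \<notin> \<int>\<^sub>\<le>\<^sub>0" "2 * \<alpha> \<notin> \<int>\<^sub>\<le>\<^sub>0" "1 - \<mu> \<notin> \<int>\<^sub>\<le>\<^sub>0"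
    using npi[of "(n + m + 1) / 2"] npi[of "(n + m + 2) / 2"] npi[of "n + m + 1"] npi[of "1 - m"] m n
    unfolding \<alpha>(1,2)[symmetric] by (simp_all add: \<alpha>_def)
  hence nz: "Gamma \<alpha> \<noteq> 0" "Gamma (\<alpha> + 1/2) \<noteq> 0" "Gamma (2 * \<alpha>) \<noteq> 0" "Gamma (1 - \<mu>) \<noteq> 0"
    by (simp_all add: Gamma_eq_zero_iff)
  \<comment> \<open>The power 2^(1 - 2\<alpha>) of the duplication formula, equal to
    2^(-\<nu>-\<mu>).\<close>
  define E where "E = exp ((1 - 2 * \<alpha>) * of_real (ln 2))"
  have E0: "E \<noteq> 0" by (simp add: E_def)
  have sp: "of_real (sqrt pi) \<noteq> (0 :: complex)" "of_real (sqrt pi) * of_real (sqrt pi) = (of_real pi :: complex)"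
    by (simp_all flip: of_real_mult)
  have dup: "Gamma \<alpha> * Gamma (\<alpha> + 1/2) = E * of_real (sqrt pi) * Gamma (2 * \<alpha>)"
    unfolding E_def using npis by (intro Gamma_legendre_duplication) auto
  have refl: "Gamma \<mu> * Gamma (1 - \<mu>) = of_real pi / sin (of_real pi * \<mu>)"
    by (rule Gamma_reflection_complex)
  have "sin (pi * m) \<noteq> 0"
    using m sin_gt_zero[of "pi * m"] by simp
  hence s0: "sin (of_real pi * \<mu>) \<noteq> 0"
    unfolding m(3) by (simp flip: of_real_mult add: sin_of_real)
  have "K * (Gamma \<alpha> * Gamma (\<alpha> + 1/2)) = of_real (4 powr (- m)) * (Gamma \<mu> * Gamma (1 - \<mu>)) * Gamma (2 * \<alpha>)"
    using K nz unfolding \<alpha> by (simp add: rGamma_inverse_Gamma field_simps)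
  hence "K * E * of_real (sqrt pi) * Gamma (2 * \<alpha>) =
      of_real (4 powr (- m)) * (of_real pi / sin (of_real pi * \<mu>)) * Gamma (2 * \<alpha>)"
    unfolding dup refl by (simp only: mult_ac)
  hence "K * E * of_real (sqrt pi) = of_real (4 powr (- m)) * (of_real pi / sin (of_real pi * \<mu>))"
    by (simp only: mult_right_cancel[OF nz(3)])
  hence "K * E * of_real (sqrt pi) * sin (of_real pi * \<mu>) = of_real (4 powr (- m)) * (of_real (sqrt pi) * of_real (sqrt pi))"
    using s0 unfolding sp(2) by simp
  hence K1: "K * E * sin (of_real pi * \<mu>) = of_real (4 powr (- m)) * of_real (sqrt pi)"
    using sp(1) by (simp add: mult_ac)
  have "of_real (4 powr (- m)) * 2 powr \<mu> = E * 2 powr \<nu>"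
  proof -
    have "(4::real) powr (- m) = (2 powr 2) powr (- m)" by simp
    also have "\<dots> = 2 powr (- (2 * m))" by (subst powr_powr) simp
    finally have "of_real (4 powr (- m)) = (2 powr (- (2 * \<mu>)) :: complex)"
      unfolding m(3) by (simp add: powr_of_real[symmetric])
    moreover have "1 - 2 * \<alpha> = - (\<nu> + \<mu>)" unfolding \<alpha>(1)[symmetric] by simp
    hence "E = 2 powr (- (\<nu> + \<mu>))"
      by (simp only: E_def powr_def) (simp add: Ln_of_real[of 2, simplified])
    ultimately show ?thesis by (simp flip: powr_add add: algebra_simps)
  qed
  moreover have "E * (K * sin (of_real pi * \<mu>) * 2 powr \<mu>) = of_real (sqrt pi) * (of_real (4 powr (- m)) * 2 powr \<mu>)"
    using K1 by (simp add: mult_ac)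
  ultimately have "E * (K * sin (of_real pi * \<mu>) * 2 powr \<mu>) = E * (of_real (sqrt pi) * 2 powr \<nu>)"
    by (simp add: mult_ac)
  hence *: "K * sin (of_real pi * \<mu>) * 2 powr \<mu> = of_real (sqrt pi) * 2 powr \<nu>"
    using E0 by simp
  show ?thesis unfolding eq[OF w] *[symmetric] by (simp only: mult_ac)
qed

section \<open>From real to complex parameters\<close>

lemma of_real_islimpt:
  assumes "a < (x::real)" "x < b"
  shows "(of_real x :: complex) islimpt of_real ` {a<..<b}"
  unfolding islimpt_approachable
proof (intro allI impI)
  fix e :: real assume "e > 0"
  define y where "y = x + min (e / 2) ((b - x) / 2)"
  have "y > x" "y < b" "y - x < e" using \<open>e > 0\<close> assms by (auto simp: y_def min_def field_simps)
  hence "(of_real y :: complex) \<in> of_real ` {a<..<b}" "of_real y \<noteq> (of_real x :: complex)"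
    "dist (of_real y :: complex) (of_real x) < e"
    using assms by (auto simp: dist_of_real dist_real_def)
  thus "\<exists>x'\<in>complex_of_real ` {a<..<b}. x' \<noteq> complex_of_real x \<and> dist x' (complex_of_real x) < e" by blast
qed

lemma entire_eqI:
  assumes "f holomorphic_on UNIV" "g holomorphic_on UNIV" "a < (b::real)"
    "\<And>x. \<lbrakk>a < x; x < b\<rbrakk> \<Longrightarrow> f (of_real x) = g (of_real x)"
  shows "f z = (g z :: complex)"
proof -
  have "f z - g z = 0"
  proof (rule analytic_continuation[of "\<lambda>z. f z - g z" UNIV])
    show "of_real ((a + b) / 2) islimpt (of_real ` {a<..<b} :: complex set)"
      using assms(3) by (intro of_real_islimpt) simp_all
    show "(\<lambda>z. f z - g z) holomorphic_on UNIV" by (intro holomorphic_intros assms)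
    show "f w - g w = 0" if "w \<in> of_real ` {a<..<b}" for w
    proof -
      from that obtain x where "a < x" "x < b" "w = of_real x" by auto
      thus ?thesis using assms(4)[of x] by simp
    qed
  qed auto
  thus ?thesis by simp
qed

text \<open>One variable at a time, at fixed w: first \<mu> leaves (0, 1) while \<nu> is real and
  positive, then \<nu> leaves (0, 1) with \<mu> already arbitrary.\<close>

lemma connection:
  fixes \<mu> \<nu> w :: complex
  assumes w: "w \<in> half_disc"
  shows "sin (of_real pi * \<mu>) * 2 powr \<mu> * (w powr \<mu> * ((1 + w) powr (- (\<nu> + \<mu> + 1)) *
      eval_fps (hyp_reg_fps ((\<nu> + \<mu> + 1) / 2) ((\<nu> + \<mu> + 2) / 2) (\<nu> + 3/2)) (1 - koebe w))) =
    of_real (sqrt pi) * 2 powr \<nu> *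
     (rGamma (\<nu> + \<mu> + 1) * eval_fps (hyp_reg_fps (\<nu> + 1) (\<nu> - \<mu> + 1) (1 - \<mu>)) w
      - rGamma (\<nu> - \<mu> + 1) * (w powr \<mu> * eval_fps (hyp_reg_fps (\<nu> + 1) (\<nu> + \<mu> + 1) (1 + \<mu>)) w))"
proof -
  note w' = half_disc_simps[OF w] norm_one_minus_koebe[OF w]
  note hol = holomorphic_intros eval_hyp_reg_fps_holomorphic_params w'
  have *: "sin (of_real pi * \<mu>) * 2 powr \<mu> * (w powr \<mu> * ((1 + w) powr (- (\<nu> + \<mu> + 1)) *
      eval_fps (hyp_reg_fps ((\<nu> + \<mu> + 1) / 2) ((\<nu> + \<mu> + 2) / 2) (\<nu> + 3/2)) (1 - koebe w))) =
    of_real (sqrt pi) * 2 powr \<nu> *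
     (rGamma (\<nu> + \<mu> + 1) * eval_fps (hyp_reg_fps (\<nu> + 1) (\<nu> - \<mu> + 1) (1 - \<mu>)) w
      - rGamma (\<nu> - \<mu> + 1) * (w powr \<mu> * eval_fps (hyp_reg_fps (\<nu> + 1) (\<nu> + \<mu> + 1) (1 + \<mu>)) w))"
    if "n > 0" "\<nu> = of_real n" for n \<nu> \<mu>
  proof (rule entire_eqI[where z = \<mu> and a = 0 and b = 1], goal_cases)
    case 1
    show ?case by (intro hol) simp_all
  next
    case 2
    show ?case by (intro hol) simp_all
  next
    case (4 m)
    show ?case using connection_real[OF 4 refl that w] .
  qed simp
  show ?thesis
  proof (rule entire_eqI[where z = \<nu> and a = 0 and b = 1], goal_cases)
    case 1
    show ?case by (intro hol) simp_all
  next
    case 2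
    show ?case by (intro hol) simp_all
  next
    case (4 n)
    show ?case using *[OF 4(1) refl] .
  qed simp
qed

section \<open>Legendre and Ferrers functions\<close>

definition cut_plane :: "complex set" where "cut_plane = {z. Im z \<noteq> 0 \<or> Re z > 1}"

lemma image_of_real_iff: "(z :: complex) \<in> of_real ` A \<longleftrightarrow> Im z = 0 \<and> Re z \<in> A"
proof
  assume "Im z = 0 \<and> Re z \<in> A"
  hence "z = of_real (Re z)" "Re z \<in> A" by (simp_all add: complex_eq_iff)
  thus "z \<in> of_real ` A" by (rule image_eqI)
qed auto

lemma D1_iff: "x \<in> D1 \<longleftrightarrow> Im x \<noteq> 0 \<or> (-1 < Re x \<and> Re x < 1)"
  unfolding D1_def Compl_iff Un_iff image_of_real_iff by auto

lemma open_cut_plane: "open cut_plane"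
proof -
  have eq: "cut_plane = {z. Im z < 0} \<union> {z. Im z > 0} \<union> {z. Re z > 1}"
    by (auto simp: cut_plane_def)
  show ?thesis unfolding eq
    by (intro open_Un open_halfspace_Im_lt open_halfspace_Im_gt open_halfspace_Re_gt)
qed

lemma connected_cut_plane: "connected cut_plane"
proof (rule starlike_imp_connected)
  show "starlike cut_plane"
    unfolding starlike_def
  proof (intro bexI ballI subsetI)
    show "2 \<in> cut_plane" by (simp add: cut_plane_def)
    fix x z assume x: "x \<in> cut_plane" and "z \<in> closed_segment 2 x"
    then obtain t where t: "0 \<le> t" "t \<le> 1" "z = (1 - t) *\<^sub>R 2 + t *\<^sub>R x" by (auto simp: in_segment)
    show "z \<in> cut_plane"
    proof (cases "Im z = 0")
      case True
      hence "t = 0 \<or> Im x = 0" unfolding t(3) by simp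
      hence "t = 0 \<or> Re x > 1" using x by (auto simp: cut_plane_def)
      moreover have "Re z = 2 - 2 * t + t * Re x" using t by simp
      moreover have "t * (Re x - 1) > 0 \<or> t = 0" if "Re x > 1" using t that by (cases "t = 0") auto
      ultimately have "Re z > 1" using t(1,2) by (smt (verit) mult_cancel_left1 right_diff_distrib')
      thus ?thesis by (simp add: cut_plane_def)
    qed (auto simp: cut_plane_def)
  qed
qed

lemma open_D1: "open D1"
proof -
  have eq: "D1 = {z. Im z < 0} \<union> {z. Im z > 0} \<union> ({z. Re z > -1} \<inter> {z. Re z < 1})"
    unfolding set_eq_iff D1_iff by auto
  show ?thesis unfolding eq
    by (intro open_Un open_Int open_halfspace_Im_lt open_halfspace_Im_gt open_halfspace_Re_gt open_halfspace_Re_lt)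
qed

lemma connected_D1: "connected D1"
proof (rule starlike_imp_connected)
  show "starlike D1"
    unfolding starlike_def
  proof (intro bexI ballI subsetI)
    show "0 \<in> D1" by (simp add: D1_iff)
    fix x z assume x: "x \<in> D1" and "z \<in> closed_segment 0 x"
    then obtain t where t: "0 \<le> t" "t \<le> 1" "z = t *\<^sub>R x" by (auto simp: in_segment)
    show "z \<in> D1"
    proof (cases "Im z = 0")
      case True
      hence "t = 0 \<or> Im x = 0" unfolding t(3) by simp
      moreover have "\<bar>Re x\<bar> < 1" if "Im x = 0" using x that unfolding D1_iff by linarith
      moreover have "\<bar>Re z\<bar> = t * \<bar>Re x\<bar>" unfolding t(3) using t(1) by (simp add: abs_mult)
      moreover have "t * \<bar>Re x\<bar> \<le> \<bar>Re x\<bar>" using t(1,2) by (simp add: mult_left_le_one_le)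
      ultimately have "\<bar>Re z\<bar> < 1" by auto
      thus ?thesis unfolding D1_iff by linarith
    qed (auto simp: D1_iff)
  qed
qed

text \<open>A value r >= 1 of the quotient would force z = (1 + r) / (1 - r), a real number below
  -1. Applied to z for the Legendre function and to -z for the Ferrers function.\<close>

lemma moebius_in_slit:
  assumes "Im z \<noteq> 0 \<or> Re z > -1"
  shows "(z - 1) / (z + 1) \<in> slit"
proof (rule ccontr)
  assume "(z - 1) / (z + 1) \<notin> slit"
  hence "(z - 1) / (z + 1) \<in> of_real ` {1..}" by simp
  then obtain r where r: "r \<ge> 1" "(z - 1) / (z + 1) = of_real r" by auto
  have z1: "z + 1 \<noteq> 0" using assms by (auto simp: complex_eq_iff)
  hence eq: "z - 1 = of_real r * (z + 1)" using r(2) by (simp add: field_simps)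
  hence *: "Im z * (1 - r) = 0" "Re z * (1 - r) = 1 + r"
    by (simp_all add: complex_eq_iff algebra_simps)
  have "r \<noteq> 1" using *(2) by auto
  hence "r > 1" "Im z = 0" using *(1) r(1) by auto
  hence "Re z + 1 > 0" using assms by auto
  hence "(Re z + 1) * (1 - r) < 0" using \<open>r > 1\<close> by (intro mult_pos_neg) auto
  moreover have "(Re z + 1) * (1 - r) = 2" using *(2) by (simp add: algebra_simps)
  ultimately show False by simp
qed

lemma inverse_square_in_slit:
  assumes "Im z \<noteq> 0 \<or> Re z > 1"
  shows "1 / z^2 \<in> slit"
proof (rule ccontr)
  assume "1 / z^2 \<notin> slit"
  hence "1 / z^2 \<in> of_real ` {1..}" by simp
  then obtain r where r: "r \<ge> 1" "1 / z^2 = of_real r" by auto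
  have "z \<noteq> 0" using assms by auto
  hence "z^2 * of_real r = 1" using r(2) by (simp add: field_simps)
  hence *: "((Re z)^2 - (Im z)^2) * r = 1" "2 * Re z * Im z * r = 0"
    by (simp_all add: complex_eq_iff power2_eq_square algebra_simps)
  have "Im z = 0"
  proof (rule ccontr)
    assume "Im z \<noteq> 0"
    hence "Re z = 0" using *(2) r(1) by auto
    hence "(Im z)^2 * r = -1" using *(1) by simp
    thus False using r(1) by (smt (verit) mult_nonneg_nonneg zero_le_power2)
  qed
  hence "Re z > 1" "(Re z)^2 * r = 1" using assms * by auto
  moreover have "(Re z)^2 > 1" using \<open>Re z > 1\<close> by (simp add: one_less_power)
  ultimately show False using r(1) by (smt (verit) mult_le_cancel_left1)
qed

text \<open>
  Expansion about \<open>z = 1\<close>; the Gamma factors are merged by \<open>\<Gamma>(\<mu>) \<Gamma>(1 - \<mu>) = \<pi> / sin(\<pi>\<mu>) = - \<Gamma>(-\<mu>) \<Gamma>(1 + \<mu>)\<close>.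
\<close>

definition legendre_Q_rhs :: "complex \<Rightarrow> complex \<Rightarrow> complex \<Rightarrow> complex" where
  "legendre_Q_rhs \<nu> \<mu> z = exp (\<i> * of_real pi * \<mu>) * 2 powr \<nu> * (z + 1) powr (- (\<nu> + 1)) *
     (of_real pi / sin (of_real pi * \<mu>)) *
     ((z + 1) powr (\<mu> / 2) * (z - 1) powr (- \<mu> / 2) * hyp2F1_reg (\<nu> + 1) (\<nu> - \<mu> + 1) (1 - \<mu>) ((z - 1) / (z + 1))
      - Gamma (\<nu> + \<mu> + 1) * rGamma (\<nu> - \<mu> + 1) * ((z + 1) powr (- \<mu> / 2) * (z - 1) powr (\<mu> / 2)) *
        hyp2F1_reg (\<nu> + 1) (\<nu> + \<mu> + 1) (1 + \<mu>) ((z - 1) / (z + 1)))"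

lemma hyp2F1_reg_comp_holomorphic:
  assumes "f holomorphic_on A" "\<And>z. z \<in> A \<Longrightarrow> f z \<in> slit"
  shows "(\<lambda>z. hyp2F1_reg a b c (f z)) holomorphic_on A"
  using holomorphic_on_compose_gen[OF assms(1) hyp2F1_reg_holomorphic, of a b c] assms(2)
  by (auto simp: o_def image_subset_iff)

lemma cut_plane_powr:
  assumes "z \<in> cut_plane"
  shows "z \<notin> \<real>\<^sub>\<le>\<^sub>0" "z + 1 \<notin> \<real>\<^sub>\<le>\<^sub>0" "z - 1 \<notin> \<real>\<^sub>\<le>\<^sub>0" "z \<noteq> 0" "z + 1 \<noteq> 0"
  using assms by (auto simp: cut_plane_def complex_nonpos_Reals_iff complex_eq_iff)

lemma legendre_Q_holomorphic: "legendre_Q \<nu> \<mu> holomorphic_on cut_plane"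
proof -
  have *: "1 / z^2 \<in> slit" if "z \<in> cut_plane" for z
    using that by (intro inverse_square_in_slit) (simp add: cut_plane_def)
  have "(\<lambda>z. of_real (sqrt pi) * exp (\<i> * of_real pi * \<mu>) * Gamma (\<nu> + \<mu> + 1)
       * ((z + 1) powr (\<mu> / 2) * (z - 1) powr (\<mu> / 2))
       / (2 powr (\<nu> + 1) * z powr (\<nu> + \<mu> + 1))
       * hyp2F1_reg ((\<nu> + \<mu> + 2) / 2) ((\<nu> + \<mu> + 1) / 2) (\<nu> + 3 / 2) (1 / z ^ 2)) holomorphic_on cut_plane"
    using cut_plane_powr
    by (intro holomorphic_intros hyp2F1_reg_comp_holomorphic *) auto
  also have "?this \<longleftrightarrow> ?thesis"
    by (rule holomorphic_cong[OF refl])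
       (simp only: legendre_Q_def hyp2F1_over_Gamma_conv_reg[OF *])
  finally show ?thesis .
qed

lemma legendre_Q_rhs_holomorphic: "legendre_Q_rhs \<nu> \<mu> holomorphic_on cut_plane"
proof -
  have *: "(z - 1) / (z + 1) \<in> slit" if "z \<in> cut_plane" for z
    using that by (intro moebius_in_slit) (auto simp: cut_plane_def)
  show ?thesis unfolding legendre_Q_rhs_def
    using cut_plane_powr
    by (intro holomorphic_intros hyp2F1_reg_comp_holomorphic *) auto
qed

text \<open>On the ray t > 1 the connection formula applies with w = (t - 1) / (t + 1), for which 1
  + w = 2 t / (t + 1) and 1 - koebe w = 1 / t^2. The identity theorem later carries the result to
  the cut plane.\<close>

lemma legendre_Q_eq_rhs_real:
  assumes t: "t > (1::real)" and \<mu>: "\<mu> \<notin> \<int>" and \<nu>\<mu>: "\<nu> + \<mu> + 1 \<notin> \<int>\<^sub>\<le>\<^sub>0"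
  shows "legendre_Q \<nu> \<mu> (of_real t) = legendre_Q_rhs \<nu> \<mu> (of_real t)"
proof -
  define w where "w = complex_of_real ((t - 1) / (t + 1))"
  have w: "w \<in> half_disc" unfolding w_def of_real_in_half_disc using t by (simp add: field_simps)
  have w_eq: "w = (of_real t - 1) / (of_real t + 1)" by (simp add: w_def)
  have pw: "of_real x powr a = exp (a * of_real (ln x))" if "x > 0" for x :: real and a :: complex
    using that by (simp add: powr_def Ln_of_real)
  \<comment> \<open>All bases are positive, so every power is the exponential of a combination of
    these four real logarithms; no branch can interfere, and exponents are compared
    linearly.\<close>
  define A where "A = complex_of_real (ln (t + 1))"
  define B where "B = complex_of_real (ln (t - 1))"
  define T where "T = complex_of_real (ln t)"
  define l where "l = complex_of_real (ln 2)"
  have pA: "(of_real t + 1) powr a = exp (a * A)" for a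
    using pw[of "t + 1" a] t by (simp add: A_def)
  have pB: "(of_real t - 1) powr a = exp (a * B)" for a
    using pw[of "t - 1" a] t by (simp add: B_def)
  have pT: "of_real t powr a = exp (a * T)" for a
    using pw[of t a] t by (simp add: T_def)
  have pl: "2 powr a = exp (a * l)" for a :: complex
    using pw[of 2 a] by (simp add: l_def)
  have pwm: "w powr a = exp (a * (B - A))" for a
  proof -
    have "ln ((t - 1) / (t + 1)) = ln (t - 1) - ln (t + 1)" using t by (subst ln_div) simp_all
    hence "B - A = of_real (ln ((t - 1) / (t + 1)))" unfolding A_def B_def by (simp only: of_real_diff)
    thus ?thesis unfolding w_def using t by (simp only:) (rule pw, simp)
  qed
  have t0: "(of_real t :: complex) + 1 \<noteq> 0" "(of_real t :: complex) \<noteq> 0"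
    using t by (simp_all add: complex_eq_iff)
  have w1: "1 + w = of_real (2 * t / (t + 1))" unfolding w_eq using t0 by (simp add: divide_simps)
  have pw1: "(1 + w) powr a = exp (a * (l + T - A))" for a
  proof -
    have "ln (2 * t / (t + 1)) = ln (2 * t) - ln (t + 1)" using t by (subst ln_div) simp_all
    also have "ln (2 * t) = ln 2 + ln t" using t by (subst ln_mult) simp_all
    finally have "l + T - A = of_real (ln (2 * t / (t + 1)))"
      unfolding A_def T_def l_def by (simp only: of_real_diff of_real_add)
    thus ?thesis unfolding w1 using t by (simp only:) (rule pw, simp)
  qed
  have "1 - w = of_real (2 / (t + 1))" unfolding w_eq using t0 by (simp add: divide_simps)
  hence "(1 - w) / (1 + w) = of_real ((2 / (t + 1)) / (2 * t / (t + 1)))"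
    unfolding w1 by (simp only: of_real_divide)
  also have "(2 / (t + 1)) / (2 * t / (t + 1)) = 1 / t" using t by (simp add: divide_simps)
  finally have "(1 - w) / (1 + w) = 1 / of_real t" by simp
  hence q: "1 - koebe w = 1 / of_real t ^ 2"
    using one_minus_koebe[OF half_disc_simps(3)[OF w]] by (simp add: power_divide)
  have nq: "norm (1 / of_real t ^ 2 :: complex) < 1" using norm_one_minus_koebe[OF w] unfolding q .
  have tc: "1 / of_real t ^ 2 \<in> slit" using t by (intro inverse_square_in_slit) simp
  define f where "f = eval_fps (hyp_reg_fps ((\<nu> + \<mu> + 1) / 2) ((\<nu> + \<mu> + 2) / 2) (\<nu> + 3/2)) (1 / of_real t ^ 2)"
  define F1 where "F1 = eval_fps (hyp_reg_fps (\<nu> + 1) (\<nu> - \<mu> + 1) (1 - \<mu>)) w"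
  define F2 where "F2 = eval_fps (hyp_reg_fps (\<nu> + 1) (\<nu> + \<mu> + 1) (1 + \<mu>)) w"
  have rF: "hyp2F1_over_Gamma ((\<nu> + \<mu> + 2) / 2) ((\<nu> + \<mu> + 1) / 2) (\<nu> + 3 / 2) (1 / of_real t ^ 2) = f"
    unfolding hyp2F1_over_Gamma_conv_reg[OF tc] hyp2F1_reg_eq[OF nq] f_def by (simp add: hyp_reg_fps_commute)
  have sp: "of_real (sqrt pi) \<noteq> (0 :: complex)" "of_real (sqrt pi) * of_real (sqrt pi) = (of_real pi :: complex)"
    by (simp_all flip: of_real_mult)
  define S where "S = sin (of_real pi * \<mu>)"
  have S: "S \<noteq> 0"
  proof
    assume "S = 0"
    then obtain k :: int where "of_real pi * \<mu> = of_real (real_of_int k * pi)"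
      by (auto simp: S_def sin_eq_0)
    hence "of_real pi * \<mu> = of_real pi * of_int k" by (simp add: mult_ac)
    hence "\<mu> = of_int k" by simp
    thus False using \<mu> by simp
  qed
  have g: "Gamma (\<nu> + \<mu> + 1) * rGamma (\<nu> + \<mu> + 1) = 1"
    using \<nu>\<mu> by (simp add: rGamma_inverse_Gamma Gamma_eq_zero_iff)
  have con: "S * exp (\<mu> * l) * (exp (\<mu> * (B - A)) * (exp (- (\<nu> + \<mu> + 1) * (l + T - A)) * f)) =
    of_real (sqrt pi) * exp (\<nu> * l) * (rGamma (\<nu> + \<mu> + 1) * F1 - rGamma (\<nu> - \<mu> + 1) * (exp (\<mu> * (B - A)) * F2))"
    using connection[OF w, of \<mu> \<nu>] unfolding q pwm pw1 pl S_def F1_def F2_def f_def .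
  have "legendre_Q_rhs \<nu> \<mu> (of_real t) = exp (\<i> * of_real pi * \<mu>) * exp (\<nu> * l) * exp (- (\<nu> + 1) * A) *
     (of_real pi / S) * (exp (\<mu> / 2 * A) * exp (- \<mu> / 2 * B) * F1 -
       Gamma (\<nu> + \<mu> + 1) * rGamma (\<nu> - \<mu> + 1) * (exp (- \<mu> / 2 * A) * exp (\<mu> / 2 * B)) * F2)"
    unfolding legendre_Q_rhs_def w_eq[symmetric] hyp2F1_reg_eq[OF half_disc_simps(7)[OF w]] pA pB pl S_def F1_def F2_def ..
  also have "exp (\<mu> / 2 * A) * exp (- \<mu> / 2 * B) * F1 -
       Gamma (\<nu> + \<mu> + 1) * rGamma (\<nu> - \<mu> + 1) * (exp (- \<mu> / 2 * A) * exp (\<mu> / 2 * B)) * F2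
     = Gamma (\<nu> + \<mu> + 1) * (exp (\<mu> / 2 * A) * exp (- \<mu> / 2 * B)) *
       (rGamma (\<nu> + \<mu> + 1) * F1 - rGamma (\<nu> - \<mu> + 1) * (exp (\<mu> * (B - A)) * F2))"
  proof -
    have e: "exp (- \<mu> / 2 * A) * exp (\<mu> / 2 * B) = exp (\<mu> / 2 * A) * exp (- \<mu> / 2 * B) * exp (\<mu> * (B - A))"
      by (simp flip: exp_add add: field_simps)
    have "H * P * (R0 * F1 - R * (W * F2)) = (H * R0) * (P * F1) - H * R * (P * W) * F2" for H P R0 R W
      by (simp add: algebra_simps)
    thus ?thesis unfolding e by (simp only: g mult_1_left)
  qed
  also have "rGamma (\<nu> + \<mu> + 1) * F1 - rGamma (\<nu> - \<mu> + 1) * (exp (\<mu> * (B - A)) * F2) =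
      S * exp (\<mu> * l) * (exp (\<mu> * (B - A)) * (exp (- (\<nu> + \<mu> + 1) * (l + T - A)) * f)) / (of_real (sqrt pi) * exp (\<nu> * l))"
    unfolding con using sp(1) by simp
  also have "exp (\<i> * of_real pi * \<mu>) * exp (\<nu> * l) * exp (- (\<nu> + 1) * A) * (of_real pi / S) *
      (Gamma (\<nu> + \<mu> + 1) * (exp (\<mu> / 2 * A) * exp (- \<mu> / 2 * B)) *
       (S * exp (\<mu> * l) * (exp (\<mu> * (B - A)) * (exp (- (\<nu> + \<mu> + 1) * (l + T - A)) * f)) / (of_real (sqrt pi) * exp (\<nu> * l))))
     = of_real (sqrt pi) * exp (\<i> * of_real pi * \<mu>) * Gamma (\<nu> + \<mu> + 1) *
       (exp (- (\<nu> + 1) * A) * exp (\<mu> / 2 * A) * exp (- \<mu> / 2 * B) * exp (\<mu> * l) * exp (\<mu> * (B - A)) * exp (- (\<nu> + \<mu> + 1) * (l + T - A))) * f"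
    unfolding sp(2)[symmetric] using S sp(1) by simp
  also have "exp (- (\<nu> + 1) * A) * exp (\<mu> / 2 * A) * exp (- \<mu> / 2 * B) * exp (\<mu> * l) * exp (\<mu> * (B - A)) * exp (- (\<nu> + \<mu> + 1) * (l + T - A))
     = exp (\<mu> / 2 * A) * exp (\<mu> / 2 * B) * exp (- ((\<nu> + 1) * l)) * exp (- ((\<nu> + \<mu> + 1) * T))"
    unfolding exp_add[symmetric] by (rule arg_cong[where f = exp]) (simp add: field_simps)
  finally have rhs: "legendre_Q_rhs \<nu> \<mu> (of_real t) = of_real (sqrt pi) * exp (\<i> * of_real pi * \<mu>) * Gamma (\<nu> + \<mu> + 1) *
      (exp (\<mu> / 2 * A) * exp (\<mu> / 2 * B) * exp (- ((\<nu> + 1) * l)) * exp (- ((\<nu> + \<mu> + 1) * T))) * f" .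
  show ?thesis
    unfolding rhs legendre_Q_def rF pA pB pT pl
      exp_minus[of "(\<nu> + 1) * l"] exp_minus[of "(\<nu> + \<mu> + 1) * T"]
    by (simp only: divide_inverse inverse_mult_distrib mult.assoc)
qed

lemma legendre_Q_eq_rhs:
  assumes "z \<in> cut_plane" "\<mu> \<notin> \<int>" "\<nu> + \<mu> + 1 \<notin> \<int>\<^sub>\<le>\<^sub>0"
  shows "legendre_Q \<nu> \<mu> z = legendre_Q_rhs \<nu> \<mu> z"
proof -
  have "legendre_Q \<nu> \<mu> z - legendre_Q_rhs \<nu> \<mu> z = 0"
  proof (rule analytic_continuation[of "\<lambda>z. legendre_Q \<nu> \<mu> z - legendre_Q_rhs \<nu> \<mu> z" cut_plane "of_real ` {1<..<3}" "of_real 2"])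
    show "(\<lambda>z. legendre_Q \<nu> \<mu> z - legendre_Q_rhs \<nu> \<mu> z) holomorphic_on cut_plane"
      by (intro holomorphic_intros legendre_Q_holomorphic legendre_Q_rhs_holomorphic)
    show "of_real 2 islimpt (of_real ` {1<..<3} :: complex set)"
      by (rule of_real_islimpt) simp_all
    show "of_real ` {1<..<3} \<subseteq> cut_plane" by (auto simp: cut_plane_def)
    show "legendre_Q \<nu> \<mu> w - legendre_Q_rhs \<nu> \<mu> w = 0" if "w \<in> of_real ` {1<..<3}" for w
    proof -
      from that obtain t where "t > 1" "w = of_real t" by auto
      thus ?thesis using legendre_Q_eq_rhs_real[of t \<mu> \<nu>] assms by simp
    qed
  qed (use assms open_cut_plane connected_cut_plane in \<open>auto simp: cut_plane_def\<close>)
  thus ?thesis by simp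
qed

text \<open>Here \<open>s\<close> is the sign of Im u, and Ln (-u) = Ln u - i \<pi> s. Encoding the
  half-plane by a sign treats both of them at once.\<close>

lemma powr_uminus_complex:
  fixes s :: real
  assumes "s = 1 \<or> s = -1" "s * Im u > 0"
  shows "(- u) powr a = exp (- (\<i> * of_real pi * of_real s * a)) * u powr a"
proof -
  have u: "u \<noteq> 0" using assms by auto
  have L: "Ln (- u) = Ln u - \<i> * of_real pi * of_real s"
    using assms u by (auto simp: Ln_minus)
  have "(- u) powr a = exp (a * (Ln u - \<i> * of_real pi * of_real s))"
    unfolding L[symmetric] using u by (simp add: powr_def)
  also have "a * (Ln u - \<i> * of_real pi * of_real s) = - (\<i> * of_real pi * of_real s * a) + a * Ln u"
    by (simp add: algebra_simps)
  finally have "(- u) powr a = exp (- (\<i> * of_real pi * of_real s * a)) * exp (a * Ln u)"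
    by (simp only: exp_add)
  thus ?thesis using u by (simp add: powr_def)
qed

text \<open>The hypergeometric argument is even in z; the phase is what is left of \<mu>/2 + \<mu>/2
  from the two numerator powers against \<nu> + \<mu> + 1 from the denominator.\<close>

lemma legendre_Q_reflect:
  fixes s :: real
  assumes s: "s = 1 \<or> s = -1" "s * Im z > 0"
  shows "legendre_Q \<nu> \<mu> z = exp (- (\<i> * of_real pi * of_real s * (\<nu> + 1))) * legendre_Q \<nu> \<mu> (- z)"
proof -
  define e where "e a = exp (- (\<i> * of_real pi * of_real s * a))" for a
  have e_add: "e (a + b) = e a * e b" for a b by (simp add: e_def exp_add[symmetric] algebra_simps)
  have e_nz: "e a \<noteq> 0" for a by (simp add: e_def)
  have "(- z + 1) powr a = e a * (z - 1) powr a" for a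
    using powr_uminus_complex[of s "z - 1" a] s by (simp add: e_def)
  moreover have "(- z - 1) powr a = e a * (z + 1) powr a" for a
    using powr_uminus_complex[of s "z + 1" a] s by (simp add: e_def)
  moreover have "(- z) powr a = e a * z powr a" for a
    using powr_uminus_complex[of s z a] s by (simp add: e_def)
  moreover have "e (\<nu> + \<mu> + 1) = e (\<nu> + 1) * (e (\<mu> / 2) * e (\<mu> / 2))"
    unfolding e_add[symmetric] by (simp add: add_ac)
  ultimately show ?thesis
    unfolding legendre_Q_def e_def[symmetric] using e_nz by (simp add: field_simps)
qed

text \<open>
  The continuation across \<open>(-1, 1)\<close> of the Legendre function on the upper (\<open>s = 1\<close>) or the
  lower (\<open>s = -1\<close>) half-plane.
\<close>

definition ferrers_side :: "complex \<Rightarrow> complex \<Rightarrow> real \<Rightarrow> complex \<Rightarrow> complex" where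
  "ferrers_side \<nu> \<mu> s z =
     exp (- (\<i> * of_real pi * of_real s * (\<nu> + 1))) * exp (\<i> * of_real pi * \<mu>) * 2 powr \<nu> * (1 - z) powr (- (\<nu> + 1)) *
     (of_real pi / sin (of_real pi * \<mu>)) *
     ((1 - z) powr (\<mu> / 2) * (1 + z) powr (- \<mu> / 2) * exp (- (\<i> * of_real pi * of_real s * (- \<mu> / 2))) *
        hyp2F1_reg (\<nu> + 1) (\<nu> - \<mu> + 1) (1 - \<mu>) ((z + 1) / (z - 1))
      - Gamma (\<nu> + \<mu> + 1) * rGamma (\<nu> - \<mu> + 1) *
        ((1 - z) powr (- \<mu> / 2) * (1 + z) powr (\<mu> / 2) * exp (- (\<i> * of_real pi * of_real s * (\<mu> / 2)))) *
        hyp2F1_reg (\<nu> + 1) (\<nu> + \<mu> + 1) (1 + \<mu>) ((z + 1) / (z - 1)))"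

lemma D1_facts:
  assumes "z \<in> D1"
  shows "1 - z \<notin> \<real>\<^sub>\<le>\<^sub>0" "1 + z \<notin> \<real>\<^sub>\<le>\<^sub>0" "1 - z \<noteq> 0" "1 + z \<noteq> 0" "z - 1 \<noteq> 0" "(z + 1) / (z - 1) \<in> slit"
proof -
  have z: "Im z \<noteq> 0 \<or> (-1 < Re z \<and> Re z < 1)" using assms D1_iff by simp
  show "1 - z \<notin> \<real>\<^sub>\<le>\<^sub>0" "1 + z \<notin> \<real>\<^sub>\<le>\<^sub>0" "1 - z \<noteq> 0" "1 + z \<noteq> 0" "z - 1 \<noteq> 0"
    using z by (auto simp: complex_nonpos_Reals_iff complex_eq_iff)
  have "(- z - 1) / (- z + 1) \<in> slit" using z by (intro moebius_in_slit) auto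
  also have "(- z - 1) / (- z + 1) = (z + 1) / (z - 1)"
    by (metis add.commute diff_conv_add_uminus minus_add_distrib minus_diff_eq minus_divide_divide)
  finally show "(z + 1) / (z - 1) \<in> slit" .
qed

lemma ferrers_side_holomorphic: "ferrers_side \<nu> \<mu> s holomorphic_on D1"
  unfolding ferrers_side_def using D1_facts
  by (intro holomorphic_intros hyp2F1_reg_comp_holomorphic) blast+

text \<open>Reflect to -z and expand about 1. Only the powers of -z - 1 are cut along (-1, 1);
  rewriting them with 1 + z and a phase that depends on \<open>s\<close> makes the formula
  holomorphic across the segment.\<close>

lemma legendre_Q_eq_ferrers_side:
  fixes s :: real
  assumes s: "s = 1 \<or> s = -1" "s * Im z > 0" and \<mu>: "\<mu> \<notin> \<int>" and \<nu>\<mu>: "\<nu> + \<mu> + 1 \<notin> \<int>\<^sub>\<le>\<^sub>0"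
  shows "legendre_Q \<nu> \<mu> z = ferrers_side \<nu> \<mu> s z"
proof -
  have Im: "Im z \<noteq> 0" using s by auto
  have w: "(- z - 1) / (1 - z) = (z + 1) / (z - 1)"
    using minus_divide_divide[of "z + 1" "z - 1"] by simp
  have p: "(- z - 1) powr a = exp (- (\<i> * of_real pi * of_real s * a)) * (1 + z) powr a" for a
  proof -
    have "(- (1 + z)) powr a = exp (- (\<i> * of_real pi * of_real s * a)) * (1 + z) powr a"
      by (rule powr_uminus_complex) (use s in simp_all)
    moreover have "- z - 1 = - (1 + z)" by simp
    ultimately show ?thesis by (simp only:)
  qed
  have q: "- z + 1 = 1 - z" by simp
  have "legendre_Q \<nu> \<mu> (- z) = legendre_Q_rhs \<nu> \<mu> (- z)"
    using Im by (intro legendre_Q_eq_rhs \<mu> \<nu>\<mu>) (simp add: cut_plane_def)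
  thus ?thesis
    unfolding legendre_Q_reflect[OF s] legendre_Q_rhs_def w p q ferrers_side_def
    by (simp only: mult_ac)
qed

text \<open>\<open>legendre_Q\<close> coincides on the open half-plane with a function continuous at
  x, so the one-sided limit is the value of that function.\<close>

lemma legendre_Q_boundary_value:
  fixes s x :: real
  assumes s: "s = 1 \<or> s = -1" and x: "-1 < x" "x < 1" and \<mu>: "\<mu> \<notin> \<int>" and \<nu>\<mu>: "\<nu> + \<mu> + 1 \<notin> \<int>\<^sub>\<le>\<^sub>0"
  shows "Lim (at (of_real x) within {z. s * Im z > 0}) (legendre_Q \<nu> \<mu>) = ferrers_side \<nu> \<mu> s (of_real x)"
proof (rule tendsto_Lim)
  have "(of_real x :: complex) islimpt {z. s * Im z > 0}"
    unfolding islimpt_approachable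
  proof (intro allI impI)
    fix e :: real assume "e > 0"
    hence "Complex x (s * e / 2) \<in> {z. s * Im z > 0} \<and> Complex x (s * e / 2) \<noteq> of_real x \<and> dist (Complex x (s * e / 2)) (of_real x) < e"
      using s by (auto simp: dist_norm cmod_def complex_eq_iff)
    thus "\<exists>x'\<in>{z. s * Im z > 0}. x' \<noteq> complex_of_real x \<and> dist x' (complex_of_real x) < e" by blast
  qed
  thus "at (complex_of_real x) within {z. s * Im z > 0} \<noteq> bot" by (simp add: trivial_limit_within)
  have "of_real x \<in> D1" using x by (simp add: D1_iff)
  hence "isCont (ferrers_side \<nu> \<mu> s) (of_real x)"
    using holomorphic_on_imp_continuous_on[OF ferrers_side_holomorphic[of \<nu> \<mu> s]] open_D1
    by (simp add: continuous_on_eq_continuous_at)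
  hence "(ferrers_side \<nu> \<mu> s \<longlongrightarrow> ferrers_side \<nu> \<mu> s (of_real x)) (at (of_real x) within {z. s * Im z > 0})"
    unfolding isCont_def by (rule tendsto_within_subset) simp
  moreover have "eventually (\<lambda>z. z \<in> {z. s * Im z > 0}) (at (of_real x) within {z. s * Im z > 0})"
    by (simp add: eventually_at_filter)
  hence "eventually (\<lambda>z. ferrers_side \<nu> \<mu> s z = legendre_Q \<nu> \<mu> z) (at (of_real x) within {z. s * Im z > 0})"
    by eventually_elim (use legendre_Q_eq_ferrers_side[OF s _ \<mu> \<nu>\<mu>] in simp)
  ultimately show "(legendre_Q \<nu> \<mu> \<longlongrightarrow> ferrers_side \<nu> \<mu> s (of_real x)) (at (of_real x) within {z. s * Im z > 0})"
    by (rule Lim_transform_eventually)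
qed

lemma ferrers_Q_segment_eq:
  fixes x :: real
  assumes x: "-1 < x" "x < 1" and \<mu>: "\<mu> \<notin> \<int>" and \<nu>\<mu>: "\<nu> + \<mu> + 1 \<notin> \<int>\<^sub>\<le>\<^sub>0"
  defines "X \<equiv> complex_of_real x"
  shows "ferrers_Q_segment \<nu> \<mu> X =
    - (2 powr \<nu>) * (1 - X) powr (- (\<nu> + 1)) * (of_real pi / sin (of_real pi * \<mu>)) *
     (cos (of_real pi * \<nu>) * ((1 - X) powr (\<mu> / 2) * (1 + X) powr (- \<mu> / 2)) *
        hyp2F1_reg (\<nu> + 1) (\<nu> - \<mu> + 1) (1 - \<mu>) ((X + 1) / (X - 1))
      - cos (of_real pi * (\<nu> + \<mu>)) * Gamma (\<nu> + \<mu> + 1) * rGamma (\<nu> - \<mu> + 1) *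
        ((1 - X) powr (- \<mu> / 2) * (1 + X) powr (\<mu> / 2)) *
        hyp2F1_reg (\<nu> + 1) (\<nu> + \<mu> + 1) (1 + \<mu>) ((X + 1) / (X - 1)))"
proof -
  have up: "Lim (at X within {z. Im z > 0}) (legendre_Q \<nu> \<mu>) = ferrers_side \<nu> \<mu> 1 X"
    using legendre_Q_boundary_value[of 1 x \<mu> \<nu>] x \<mu> \<nu>\<mu> by (simp add: X_def)
  have down: "Lim (at X within {z. Im z < 0}) (legendre_Q \<nu> \<mu>) = ferrers_side \<nu> \<mu> (-1) X"
    using legendre_Q_boundary_value[of "-1" x \<mu> \<nu>] x \<mu> \<nu>\<mu> by (simp add: X_def)
  define p where "p = exp (\<i> * of_real pi * \<mu> / 2)"
  define p' where "p' = exp (- (\<i> * of_real pi * \<mu> / 2))"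
  define n where "n = exp (\<i> * of_real pi * \<nu>)"
  define n' where "n' = exp (- (\<i> * of_real pi * \<nu>))"
  have pp: "p * p' = 1" by (simp add: p_def p'_def exp_minus)
  have e1: "exp (\<i> * of_real pi * \<mu>) = p * p" "exp (- (\<i> * of_real pi * \<mu>)) = p' * p'"
    unfolding p_def p'_def exp_add[symmetric] by (simp_all add: mult_ac)
  have e2: "exp (- (\<i> * of_real pi * of_real 1 * (\<nu> + 1))) = - n'"
    "exp (- (\<i> * of_real pi * of_real (-1) * (\<nu> + 1))) = - n"
    unfolding n_def n'_def by (simp_all add: ring_distribs exp_diff exp_add)
  have e3: "exp (- (\<i> * of_real pi * of_real 1 * (- \<mu> / 2))) = p"
    "exp (- (\<i> * of_real pi * of_real 1 * (\<mu> / 2))) = p'"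
    "exp (- (\<i> * of_real pi * of_real (-1) * (- \<mu> / 2))) = p'"
    "exp (- (\<i> * of_real pi * of_real (-1) * (\<mu> / 2))) = p"
    by (simp_all add: p_def p'_def)
  have c1: "cos (of_real pi * \<nu>) = (n + n') / 2"
    by (simp add: cos_exp_eq n_def n'_def mult_ac)
  have c2: "cos (of_real pi * (\<nu> + \<mu>)) = (n * (p * p) + n' * (p' * p')) / 2"
    unfolding e1[symmetric] n_def n'_def exp_add[symmetric] cos_exp_eq
    by (simp add: algebra_simps)
  \<comment> \<open>Only p p' = 1 is used. In the first term the \<mu>-phases cancel, leaving n and
    n', hence cos(\<pi>\<nu>); in the second, p^2 and p'^2 remain, hence cos(\<pi>(\<nu>+\<mu>)).
    The overall sign is that of exp(i\<pi>) in \<open>e2\<close>.\<close>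
  have alg: "1 / 2 * (p' * (p' * p') * (- n' * (p * p) * a * b * c * (u * p * R1 - H * R * (v * p') * R2)) +
       p * (p' * p') * (- n * (p * p) * a * b * c * (u * p' * R1 - H * R * (v * p) * R2))) =
     - a * b * c * ((n + n') / 2 * u * R1 - (n * (p * p) + n' * (p' * p')) / 2 * H * R * v * R2)" for a b c u v R1 R2 H R
  proof -
    have X: "p' * (p' * p') * (- n' * (p * p) * a * b * c * (u * p * R1 - H * R * (v * p') * R2)) =
       - n' * a * b * c * ((p * p')^3 * u * R1 - (p * p')^2 * H * R * (v * (p' * p')) * R2)"
      by (simp add: power2_eq_square power3_eq_cube algebra_simps)
    have Y: "p * (p' * p') * (- n * (p * p) * a * b * c * (u * p' * R1 - H * R * (v * p) * R2)) =
       - n * a * b * c * ((p * p')^3 * u * R1 - (p * p')^2 * H * R * (v * (p * p)) * R2)"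
      by (simp add: power2_eq_square power3_eq_cube algebra_simps)
    show ?thesis unfolding X Y pp by (simp add: algebra_simps add_divide_distrib)
  qed
  show ?thesis
    unfolding ferrers_Q_segment_def up down unfolding ferrers_side_def e2 e3 c1 c2
    unfolding e1 p_def[symmetric] p'_def[symmetric] by (rule alg)
qed

theorem theorem3p4:
  fixes x \<nu> \<mu> :: complex
  assumes "x \<in> D1"
    and "\<mu> \<notin> \<int>"
    and "\<nu> + \<mu> \<notin> {- of_nat n | n :: nat. n \<ge> 1}"
  shows "ferrers_Q \<nu> \<mu> x =
    - (2 powr \<nu>) / (1 - x) powr (\<nu> + 1) *
      (Gamma \<mu> * cos (of_real pi * \<nu>) * ((1 - x) / (1 + x)) powr (\<mu> / 2)
         * hyp2F1 (\<nu> + 1) (\<nu> - \<mu> + 1) (1 - \<mu>) ((x + 1) / (x - 1))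
       + Gamma (- \<mu>) * cos (of_real pi * (\<nu> + \<mu>)) * Gamma (\<nu> + \<mu> + 1) * rGamma (\<nu> - \<mu> + 1)
         * ((1 + x) / (1 - x)) powr (\<mu> / 2)
         * hyp2F1 (\<nu> + 1) (\<nu> + \<mu> + 1) (1 + \<mu>) ((x + 1) / (x - 1)))"
proof -
  have \<nu>\<mu>: "\<nu> + \<mu> + 1 \<notin> \<int>\<^sub>\<le>\<^sub>0"
  proof
    assume "\<nu> + \<mu> + 1 \<in> \<int>\<^sub>\<le>\<^sub>0"
    then obtain k :: nat where "\<nu> + \<mu> + 1 = - of_nat k" by (auto elim!: nonpos_Ints_cases')
    hence "\<nu> + \<mu> + 1 - 1 = - of_nat k - 1" by (simp only:)
    hence "\<nu> + \<mu> = - of_nat (Suc k)" by simp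
    hence "\<nu> + \<mu> \<in> {- of_nat n | n :: nat. n \<ge> 1}" by (intro CollectI exI[of _ "Suc k"]) simp
    thus False using assms(3) by contradiction
  qed
  have npi: "1 - \<mu> \<notin> \<int>\<^sub>\<le>\<^sub>0" "1 + \<mu> \<notin> \<int>\<^sub>\<le>\<^sub>0"
  proof -
    have "\<mu> \<in> \<int>" if "1 - \<mu> \<in> \<int>" using Ints_diff[OF Ints_1 that] by simp
    moreover have "\<mu> \<in> \<int>" if "1 + \<mu> \<in> \<int>" using Ints_diff[OF that Ints_1] by simp
    ultimately show "1 - \<mu> \<notin> \<int>\<^sub>\<le>\<^sub>0" "1 + \<mu> \<notin> \<int>\<^sub>\<le>\<^sub>0"
      using assms(2) nonpos_Ints_subset_Ints by blast+
  qed
  \<comment> \<open>The claimed right-hand side written with the regularized functions, whose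
    holomorphy on the slit plane is already known.\<close>
  define T where "T z = - (2 powr \<nu>) / (1 - z) powr (\<nu> + 1) *
      (Gamma \<mu> * cos (of_real pi * \<nu>) * ((1 - z) / (1 + z)) powr (\<mu> / 2)
         * (Gamma (1 - \<mu>) * hyp2F1_reg (\<nu> + 1) (\<nu> - \<mu> + 1) (1 - \<mu>) ((z + 1) / (z - 1)))
       + Gamma (- \<mu>) * cos (of_real pi * (\<nu> + \<mu>)) * Gamma (\<nu> + \<mu> + 1) * rGamma (\<nu> - \<mu> + 1)
         * ((1 + z) / (1 - z)) powr (\<mu> / 2)
         * (Gamma (1 + \<mu>) * hyp2F1_reg (\<nu> + 1) (\<nu> + \<mu> + 1) (1 + \<mu>) ((z + 1) / (z - 1))))" for z
  \<comment> \<open>Principal powers of the quotients are thus holomorphic on all of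
    \<open>D1\<close>; splitting them into powers of 1 - z and 1 + z is then needed only on the real
    segment.\<close>
  have ratio: "(1 - z) / (1 + z) \<notin> \<real>\<^sub>\<le>\<^sub>0" "(1 + z) / (1 - z) \<notin> \<real>\<^sub>\<le>\<^sub>0" if "z \<in> D1" for z
  proof -
    have *: "(1 - y) / (1 + y) \<notin> \<real>\<^sub>\<le>\<^sub>0" if "y \<in> D1" for y
    proof
      assume "(1 - y) / (1 + y) \<in> \<real>\<^sub>\<le>\<^sub>0"
      then obtain r where r: "r \<le> 0" "(1 - y) / (1 + y) = of_real r" by (auto elim!: nonpos_Reals_cases)
      hence "1 - y = of_real r * (1 + y)" using D1_facts(4)[OF that] by (simp add: field_simps)
      hence c: "Im y * (1 + r) = 0" "Re y * (1 + r) = 1 - r"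
        by (simp_all add: complex_eq_iff algebra_simps)
      have "1 + r \<noteq> 0" using c(2) r(1) by auto
      hence "Im y = 0" using c(1) by simp
      hence y: "-1 < Re y" "Re y < 1" using that D1_iff by auto
      have "(1 - Re y) = r * (1 + Re y)" using c(2) by (simp add: algebra_simps)
      moreover have "r * (1 + Re y) \<le> 0" using r(1) y by (intro mult_nonpos_nonneg) auto
      ultimately show False using y by simp
    qed
    show "(1 - z) / (1 + z) \<notin> \<real>\<^sub>\<le>\<^sub>0" by (rule *[OF that])
    have "- z \<in> D1" using that by (auto simp: D1_iff)
    from *[OF this] show "(1 + z) / (1 - z) \<notin> \<real>\<^sub>\<le>\<^sub>0" by simp
  qed
  have "ferrers_Q \<nu> \<mu> x = T x"
    unfolding ferrers_Q_def
  proof (rule analytic_extension_unique)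
    show "T holomorphic_on D1"
      unfolding T_def using D1_facts ratio
      by (intro holomorphic_intros hyp2F1_reg_comp_holomorphic) auto
    show "open D1" "connected D1" by (rule open_D1 connected_D1)+
    show "complex_of_real ` {-1<..<1} \<subseteq> D1" by (auto simp: D1_iff)
    show "of_real 0 islimpt (complex_of_real ` {-1<..<1})" by (rule of_real_islimpt) simp_all
    show "of_real 0 \<in> D1" by (simp add: D1_iff)
    show "x \<in> D1" by fact
    show "T z = ferrers_Q_segment \<nu> \<mu> z" if "z \<in> complex_of_real ` {-1<..<1}" for z
    proof -
      from that obtain y where "z = of_real y" "y \<in> {-1<..<1}" by (rule imageE)
      hence y: "-1 < y" "y < 1" "z = of_real y" by simp_all
      have pw: "of_real r powr a = exp (a * of_real (ln r))" if "r > 0" for r :: real and a :: complex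
        using that by (simp add: powr_def Ln_of_real)
      define A where "A = complex_of_real (ln (1 - y))"
      define B where "B = complex_of_real (ln (1 + y))"
      have p1: "(1 - z) powr a = exp (a * A)" "(1 + z) powr a = exp (a * B)" for a
        using pw[of "1 - y" a] pw[of "1 + y" a] y by (simp_all add: A_def B_def)
      have p2: "((1 - z) / (1 + z)) powr a = exp (a * (A - B))" "((1 + z) / (1 - z)) powr a = exp (a * (B - A))" for a
      proof -
        have "(1 - z) / (1 + z) = of_real ((1 - y) / (1 + y))" "(1 + z) / (1 - z) = of_real ((1 + y) / (1 - y))"
          using y(3) by simp_all
        moreover have "A - B = of_real (ln ((1 - y) / (1 + y)))" "B - A = of_real (ln ((1 + y) / (1 - y)))"
          using y(1,2) by (simp_all add: ln_div A_def B_def)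
        ultimately show "((1 - z) / (1 + z)) powr a = exp (a * (A - B))" "((1 + z) / (1 - z)) powr a = exp (a * (B - A))"
          using y(1,2) by (simp_all only:) (rule pw, simp)+
      qed
      define S where "S = complex_of_real pi / sin (of_real pi * \<mu>)"
      have G1: "Gamma \<mu> * Gamma (1 - \<mu>) = S"
        unfolding S_def by (rule Gamma_reflection_complex)
      \<comment> \<open>Reflection at -\<mu>; the sign from the odd sine turns the difference of the
        two terms into the sum in the theorem.\<close>
      have G2: "Gamma (- \<mu>) * Gamma (1 + \<mu>) = - S"
        using Gamma_reflection_complex[of "- \<mu>"] by (simp add: S_def)
      have u: "exp (\<mu> / 2 * A) * exp (- \<mu> / 2 * B) = exp (\<mu> / 2 * (A - B))"
        "exp (- \<mu> / 2 * A) * exp (\<mu> / 2 * B) = exp (\<mu> / 2 * (B - A))"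
        unfolding exp_add[symmetric] by (rule arg_cong[where f = exp], simp add: algebra_simps)+
      have "ferrers_Q_segment \<nu> \<mu> z = - (2 powr \<nu>) * exp (- (\<nu> + 1) * A) * S *
       (cos (of_real pi * \<nu>) * exp (\<mu> / 2 * (A - B)) * hyp2F1_reg (\<nu> + 1) (\<nu> - \<mu> + 1) (1 - \<mu>) ((z + 1) / (z - 1))
        - cos (of_real pi * (\<nu> + \<mu>)) * Gamma (\<nu> + \<mu> + 1) * rGamma (\<nu> - \<mu> + 1) * exp (\<mu> / 2 * (B - A)) *
        hyp2F1_reg (\<nu> + 1) (\<nu> + \<mu> + 1) (1 + \<mu>) ((z + 1) / (z - 1)))"
        using ferrers_Q_segment_eq[OF y(1,2) assms(2) \<nu>\<mu>] unfolding y(3)[symmetric] p1 u S_def[symmetric] .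
      also have "\<dots> = T z"
      proof -
        have e: "exp (- (\<nu> + 1) * A) = 1 / exp ((\<nu> + 1) * A)"
          by (simp add: exp_minus[symmetric] divide_inverse algebra_simps)
        have alg: "- a * (1 / b) * S * (c * u * R1 - d * g * h * v * R2) =
          - a / b * (m1 * c * u * (m2 * R1) + m3 * d * g * h * v * (m4 * R2))"
          if "m1 * m2 = S" "m3 * m4 = - S" for a b c d g h u v R1 R2 m1 m2 m3 m4
        proof -
          have eq: "m1 * c * u * (m2 * R1) + m3 * d * g * h * v * (m4 * R2) =
            (m1 * m2) * (c * u * R1) + (m3 * m4) * (d * g * h * v * R2)" by (simp only: mult_ac)
          show ?thesis unfolding eq that by (simp add: algebra_simps)
        qed
        show ?thesis unfolding T_def p1 p2 e by (rule alg[OF G1 G2])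
      qed
      finally show ?thesis by (rule sym)
    qed
  qed
  also have "T x = - (2 powr \<nu>) / (1 - x) powr (\<nu> + 1) *
      (Gamma \<mu> * cos (of_real pi * \<nu>) * ((1 - x) / (1 + x)) powr (\<mu> / 2)
         * hyp2F1 (\<nu> + 1) (\<nu> - \<mu> + 1) (1 - \<mu>) ((x + 1) / (x - 1))
       + Gamma (- \<mu>) * cos (of_real pi * (\<nu> + \<mu>)) * Gamma (\<nu> + \<mu> + 1) * rGamma (\<nu> - \<mu> + 1)
         * ((1 + x) / (1 - x)) powr (\<mu> / 2)
         * hyp2F1 (\<nu> + 1) (\<nu> + \<mu> + 1) (1 + \<mu>) ((x + 1) / (x - 1)))"
    unfolding T_def hyp2F1_conv_reg[OF npi(1) D1_facts(6)[OF assms(1)]]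
      hyp2F1_conv_reg[OF npi(2) D1_facts(6)[OF assms(1)]] ..
  finally show ?thesis .
qed

end
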